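(* Let $m_1,m_2\in\mathbb{Z}_{\ge 0}$, let $\lambda=m_1\omega_1+m_2\omega_2=(m_1+m_2)\epsilon_1+m_2\epsilon_2$, identified with the partition $(m_1+m_2,m_2)$, and let $L(\lambda)$ be the finite dimensional irreducible representation of $\mathfrak{sp}_4$ over $\mathbb{C}$ with highest weight $\lambda$ and highest weight vector $v_\lambda\neq 0$. Let $$F=\left\{ f_1^{a_4} f_2^{a_3} f_1^{a_2} f_2^{a_1} v_{\lambda} \;\middle|\; \begin{aligned} a_i &\in \mathbb{Z}_{\ge 0},\ i=1,2,3,4,\\ 0 &\le a_1 \le m_2,\\ 0 &\le a_2 \le m_1+2a_1,\\ 0 &\le a_3 \le \min\{\tfrac12(a_2+m_1),\, a_2\},\\ 0 &\le a_4 \le \min\{m_1,a_3\}\end{aligned}\right\}.$$ Then: (i) there exists a weight-preserving one-to-one correspondence between $F$ and the set $\mathrm{KN}_\lambda(4)$ of Kashiwara-Nakashima tableaux of $\mathfrak{sp}_4$ of shape $\lambda$ (that is, a bijection under which the weight of each vector of $F$ equals the weight of the corresponding tableau); (ii) $F$ is a basis of $L(\lambda)$.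
   Context: $\mathfrak{sp}_4$ is realized as the Lie algebra of complex $4\times 4$ block matrices $\begin{pmatrix} A & B\\ C & -A^t\end{pmatrix}$ with $A,B,C\in M_{2\times 2}(\mathbb{C})$, $B^t=B$, $C^t=C$. With $E_{ij}$ the elementary matrices, it is generated by $e_1=E_{12}-E_{43}$, $f_1=E_{21}-E_{34}$, $h_1=E_{11}-E_{22}-E_{33}+E_{44}$, $e_2=E_{24}$, $f_2=E_{42}$, $h_2=E_{22}-E_{44}$. The Cartan subalgebra is the diagonal part, and $\epsilon_i$ is the functional sending a matrix to its $i$-th diagonal entry ($i=1,2$). The simple roots are $\alpha_1=\epsilon_1-\epsilon_2$, $\alpha_2=2\epsilon_2$, and the fundamental weights are $\omega_1=\epsilon_1$, $\omega_2=\epsilon_1+\epsilon_2$. Thus $f_1$, $f_2$ are root vectors for the negative simple roots $\epsilon_2-\epsilon_1$ and $-2\epsilon_2$. Kashiwara-Nakashima (KN) tableaux of $\mathfrak{sp}_4$: let $\mathcal{N}=\{1,2,\overline{2},\overline{1}\}$ with total order $1<2<\overline{2}<\overline{1}$, and let $\lambda=(\lambda_1,\lambda_2)$ with $\lambda_1\ge\lambda_2\ge 0$. A KN tableau $T$ of shape $\lambda$ is a filling of the (left-justified) Young diagram of $\lambda$, with $\lambda_1$ boxes in the first row and $\lambda_2$ boxes in the second row, by entries of $\mathcal{N}$ such that: (a) entries weakly increase from left to right along each row and strictly increase down each column; (b) $1$ and $\overline{1}$ do not appear in the same column; (c) for two adjacent columns of length 2, the following two configurations are forbidden: the left column has top entry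 $2$ and the right column is $2$ over $\overline{2}$; the left column is $2$ over $\overline{2}$ and the right column has bottom entry $\overline{2}$. $\mathrm{KN}_\lambda(4)$ is the set of all such tableaux. The weight of $T$ is $\mathrm{wt}(T)=(k_1-k_{\overline{1}})\epsilon_1+(k_2-k_{\overline{2}})\epsilon_2$, where $k_x$ is the number of entries of $T$ equal to $x$. *)

theory Defs
  imports "HOL-Analysis.Analysis"
begin

definition block_matrix ::
  "complex^2^2 \<Rightarrow> complex^2^2 \<Rightarrow> complex^2^2 \<Rightarrow> complex^2^2 \<Rightarrow> complex^4^4" where
  "block_matrix A B C D = vector
    [vector [A$1$1, A$1$2, B$1$1, B$1$2],
     vector [A$2$1, A$2$2, B$2$1, B$2$2],
     vector [C$1$1, C$1$2, D$1$1, D$1$2],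
     vector [C$2$1, C$2$2, D$2$1, D$2$2]]"

definition sp4 :: "(complex^4^4) set" where
  "sp4 = {block_matrix A B C (- transpose A) | A B C. transpose B = B \<and> transpose C = C}"

definition lie_bracket :: "complex^4^4 \<Rightarrow> complex^4^4 \<Rightarrow> complex^4^4" where
  "lie_bracket X Y = X ** Y - Y ** X"

definition matrix_scale :: "complex \<Rightarrow> complex^4^4 \<Rightarrow> complex^4^4" where
  "matrix_scale c X = (\<chi> i j. c * X $ i $ j)"

definition elementary :: "4 \<Rightarrow> 4 \<Rightarrow> complex^4^4" where
  "elementary i j = (\<chi> k l. if k = i \<and> l = j then 1 else 0)"

definition e1 :: "complex^4^4" where "e1 = elementary 1 2 - elementary 4 3"
definition f1 :: "complex^4^4" where "f1 = elementary 2 1 - elementary 3 4"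
definition e2 :: "complex^4^4" where "e2 = elementary 2 4"
definition f2 :: "complex^4^4" where "f2 = elementary 4 2"

definition cartan :: "(complex^4^4) set" where
  "cartan = {H \<in> sp4. \<forall>i j. i \<noteq> j \<longrightarrow> H $ i $ j = 0}"

text \<open>Weights are linear functionals on the Cartan subalgebra. They are written as functions on
  all matrices; only their values on \<^const>\<open>cartan\<close> are ever used.\<close>

type_synonym weight = "complex^4^4 \<Rightarrow> complex"

definition eps1 :: weight where "eps1 H = H $ 1 $ 1"
definition eps2 :: weight where "eps2 H = H $ 2 $ 2"

definition omega1 :: weight where "omega1 H = eps1 H"
definition omega2 :: weight where "omega2 H = eps1 H + eps2 H"

definition dominant_weight :: "nat \<Rightarrow> nat \<Rightarrow> weight" where
  "dominant_weight m1 m2 H = of_nat m1 * omega1 H + of_nat m2 * omega2 H"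

text \<open>The representation space is the whole type \<open>'v\<close>, with complex scalar multiplication
  \<open>scale\<close>; the values of \<open>rho\<close> outside \<^const>\<open>sp4\<close> are irrelevant.\<close>

locale sp4_representation = vector_space scale
  for scale :: "complex \<Rightarrow> 'v::ab_group_add \<Rightarrow> 'v" +
  fixes rho :: "complex^4^4 \<Rightarrow> 'v \<Rightarrow> 'v"
  assumes rho_linear: "X \<in> sp4 \<Longrightarrow> Vector_Spaces.linear scale scale (rho X)"
    and rho_add: "X \<in> sp4 \<Longrightarrow> Y \<in> sp4 \<Longrightarrow> rho (X + Y) w = rho X w + rho Y w"
    and rho_scale: "X \<in> sp4 \<Longrightarrow> rho (matrix_scale c X) w = scale c (rho X w)"
    and rho_bracket: "X \<in> sp4 \<Longrightarrow> Y \<in> sp4 \<Longrightarrow>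
      rho (lie_bracket X Y) w = rho X (rho Y w) - rho Y (rho X w)"
begin

definition finite_dim :: bool where
  "finite_dim \<longleftrightarrow> (\<exists>B. finite B \<and> span B = UNIV)"

definition irreducible :: bool where
  "irreducible \<longleftrightarrow> (\<exists>w::'v. w \<noteq> 0) \<and>
    (\<forall>W. subspace W \<and> (\<forall>X\<in>sp4. rho X ` W \<subseteq> W) \<longrightarrow> W = {0} \<or> W = UNIV)"

definition weight_vector :: "weight \<Rightarrow> 'v \<Rightarrow> bool" where
  "weight_vector \<mu> w \<longleftrightarrow> w \<noteq> 0 \<and> (\<forall>H\<in>cartan. rho H w = scale (\<mu> H) w)"

definition highest_weight_vector :: "weight \<Rightarrow> 'v \<Rightarrow> bool" where
  "highest_weight_vector \<mu> w \<longleftrightarrow> weight_vector \<mu> w \<and> rho e1 w = 0 \<and> rho e2 w = 0"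

definition is_basis :: "'v set \<Rightarrow> bool" where
  "is_basis B \<longleftrightarrow> independent B \<and> span B = UNIV"

end

locale sp4_irrep = sp4_representation scale rho
  for scale :: "complex \<Rightarrow> 'v::ab_group_add \<Rightarrow> 'v" and rho +
  fixes m1 m2 :: nat and v :: 'v
  assumes finite_dim: finite_dim
    and irreducible: irreducible
    and highest_weight_vector: "highest_weight_vector (dominant_weight m1 m2) v"

definition monomial_vectors ::
  "(complex^4^4 \<Rightarrow> 'v \<Rightarrow> 'v) \<Rightarrow> nat \<Rightarrow> nat \<Rightarrow> 'v \<Rightarrow> 'v set" where
  "monomial_vectors rho m1 m2 v =
    {(rho f1 ^^ a4) ((rho f2 ^^ a3) ((rho f1 ^^ a2) ((rho f2 ^^ a1) v))) | a1 a2 a3 a4 :: nat.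
      a1 \<le> m2 \<and>
      a2 \<le> m1 + 2 * a1 \<and>
      real a3 \<le> min ((1/2) * (real a2 + real m1)) (real a2) \<and>
      a4 \<le> min m1 a3}"

datatype letter = One | Two | Two_bar | One_bar

fun letter_rank :: "letter \<Rightarrow> nat" where
  "letter_rank One = 0"
| "letter_rank Two = 1"
| "letter_rank Two_bar = 2"
| "letter_rank One_bar = 3"

instantiation letter :: linorder
begin

definition less_eq_letter :: "letter \<Rightarrow> letter \<Rightarrow> bool" where "x \<le> y \<longleftrightarrow> letter_rank x \<le> letter_rank y"
definition less_letter :: "letter \<Rightarrow> letter \<Rightarrow> bool" where "x < y \<longleftrightarrow> letter_rank x < letter_rank y"

instance
proof
  fix x y :: letter
  assume "x \<le> y" "y \<le> x"
  then show "x = y"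
    by (cases x; cases y) (simp_all add: less_eq_letter_def)
qed (auto simp: less_eq_letter_def less_letter_def)

end

text \<open>A filling is given by its two rows, read from left to right.\<close>

type_synonym tableau = "letter list \<times> letter list"

definition KN_tableaux :: "nat \<Rightarrow> nat \<Rightarrow> tableau set" where
  "KN_tableaux l1 l2 = {(r, s).
    l2 \<le> l1 \<and> length r = l1 \<and> length s = l2 \<and>
    sorted r \<and> sorted s \<and> (\<forall>j<l2. r ! j < s ! j) \<and>
    (\<forall>j<l2. \<not> {One, One_bar} \<subseteq> {r ! j, s ! j}) \<and>
    (\<forall>j. j + 1 < l2 \<longrightarrow>
      \<not> (r ! j = Two \<and> r ! (j + 1) = Two \<and> s ! (j + 1) = Two_bar) \<and>
      \<not> (r ! j = Two \<and> s ! j = Two_bar \<and> s ! (j + 1) = Two_bar))}"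

definition multiplicity_in :: "letter \<Rightarrow> tableau \<Rightarrow> nat" where
  "multiplicity_in x T = count_list (fst T) x + count_list (snd T) x"

definition wt :: "tableau \<Rightarrow> weight" where
  "wt T H =
    (of_nat (multiplicity_in One T) - of_nat (multiplicity_in One_bar T)) * eps1 H +
    (of_nat (multiplicity_in Two T) - of_nat (multiplicity_in Two_bar T)) * eps2 H"

end

theory Submission
  imports Defs
begin

text \<open>Independence. The vector space with basis all words in a basis of
  \<open>\<complex>\<^sup>4 \<oplus> \<Lambda>\<^sup>2 \<complex>\<^sup>4\<close> carries an action of the Chevalley generators for which transposition is an
  anti-involution exchanging \<open>e\<^sub>i\<close> and \<open>f\<^sub>i\<close>; since the associated form is positive definite, every
  relation between the words in \<open>f\<^sub>1, f\<^sub>2\<close> applied to \<open>v\<close> also holds for the highest weight word.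
  There the coordinates of \<open>exp (s f\<^sub>1) exp (r f\<^sub>2) exp (t f\<^sub>1) exp (q f\<^sub>2)\<close> applied to that word are the
  products of \<open>m\<^sub>1\<close> factors from \<open>(1, t + s, t r, t r s)\<close> and \<open>m\<^sub>2\<close> factors from
  \<open>(1, q + r, q t + (q + r) s, q (t + s)\<^sup>2 + r s\<^sup>2, q t\<^sup>2 r)\<close>; the terms of highest degree in \<open>q, t\<close>
  in these are single monomials, and their products are exactly the exponents in \<open>F\<close>.

  Spanning. All monomials \<open>f\<^sub>1\<^sup>a f\<^sub>2\<^sup>c f\<^sub>1\<^sup>b f\<^sub>2\<^sup>d v\<close> span, because their span is stable under the
  Borel subalgebra and contains the lowest weight vector (nonzero by independence). A
  linear functional that vanishes on \<open>F\<close> is shown to vanish on all of them by induction on \<open>c\<close>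
  with \<open>c + d\<close> fixed: for \<open>b < max c (2 c - m\<^sub>1)\<close> the vector \<open>f\<^sub>2\<^sup>c f\<^sub>1\<^sup>b f\<^sub>2\<^sup>d v\<close> is a combination of
  those with smaller \<open>c\<close>, and for fixed \<open>a + b\<close> the values of the functional are
  polynomial in \<open>a\<close> of degree at most \<open>2 c\<close>, with \<open>2 c + 1\<close> known zeros.\<close>

section \<open>Derivations on the tensor algebra, as functions on words\<close>

text \<open>Tensors of every rank live in one function type, so that the rank does not enter the
  types. A derivation kills scalars, whence the value 0 on the empty word.\<close>

fun act :: "('a::finite \<Rightarrow> 'a \<Rightarrow> complex) \<Rightarrow> ('a list \<Rightarrow> complex) \<Rightarrow> 'a list \<Rightarrow> complex" where
  "act A \<psi> [] = 0"
| "act A \<psi> (i # w) = (\<Sum>j\<in>UNIV. A i j * \<psi> (j # w)) + act A (\<lambda>w. \<psi> (i # w)) w"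

definition apply_mat :: "('a::finite \<Rightarrow> 'a \<Rightarrow> complex) \<Rightarrow> ('a \<Rightarrow> complex) \<Rightarrow> 'a \<Rightarrow> complex" where
  "apply_mat A \<alpha> i = (\<Sum>j\<in>UNIV. A i j * \<alpha> j)"

fun tensor :: "('a \<Rightarrow> complex) \<Rightarrow> ('a list \<Rightarrow> complex) \<Rightarrow> 'a list \<Rightarrow> complex" where
  "tensor \<alpha> \<beta> [] = 0"
| "tensor \<alpha> \<beta> (i # w) = \<alpha> i * \<beta> w"

lemma act_lincomb: "act A (\<lambda>w. c * \<psi> w + \<phi> w) = (\<lambda>w. c * act A \<psi> w + act A \<phi> w)"
proof
  show "act A (\<lambda>w. c * \<psi> w + \<phi> w) w = c * act A \<psi> w + act A \<phi> w" for w
    by (induction w arbitrary: \<psi> \<phi>)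
      (simp_all add: sum_distrib_left sum.distrib algebra_simps)
qed

lemma act_zero: "act A (\<lambda>w. 0) = (\<lambda>w. 0)"
proof
  show "act A (\<lambda>w. 0) w = 0" for w by (induction w) simp_all
qed

lemma act_add: "act A (\<lambda>w. \<psi> w + \<phi> w) = (\<lambda>w. act A \<psi> w + act A \<phi> w)"
  using act_lincomb[of A 1] by simp

lemma act_scale: "act A (\<lambda>w. c * \<psi> w) = (\<lambda>w. c * act A \<psi> w)"
  using act_lincomb[of A c \<psi> "\<lambda>_. 0"] by (simp add: act_zero)

lemma act_sum: "act A (\<lambda>w. \<Sum>k\<in>K. \<psi> k w) = (\<lambda>w. \<Sum>k\<in>K. act A (\<psi> k) w)"
  by (induction K rule: infinite_finite_induct) (simp_all add: act_zero act_add)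

text \<open>Terms in which \<open>A\<close> and \<open>B\<close> hit different letters are symmetric
  in the two and cancel in the commutator; the terms on a common letter give the matrix
  commutator.\<close>

lemma act_bracket:
  "act A (act B \<psi>) w = act B (act A \<psi>) w
    + act (\<lambda>i k. \<Sum>j\<in>UNIV. A i j * B j k - B i j * A j k) \<psi> w"
proof (induction w arbitrary: \<psi>)
  case (Cons i w)
  have expand: "act A (act B \<psi>) (i # w) =
      (\<Sum>k\<in>UNIV. (\<Sum>j\<in>UNIV. A i j * B j k) * \<psi> (k # w))
      + (\<Sum>j\<in>UNIV. A i j * act B (\<lambda>w. \<psi> (j # w)) w)
      + (\<Sum>j\<in>UNIV. B i j * act A (\<lambda>w. \<psi> (j # w)) w)
      + act A (act B (\<lambda>w. \<psi> (i # w))) w" for A B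
  proof -
    have 1: "(\<Sum>j\<in>UNIV. A i j * (\<Sum>k\<in>UNIV. B j k * \<psi> (k # w))) =
        (\<Sum>k\<in>UNIV. (\<Sum>j\<in>UNIV. A i j * B j k) * \<psi> (k # w))"
      by (simp add: sum_distrib_left sum_distrib_right mult.assoc) (rule sum.swap)
    show ?thesis
      by (simp add: distrib_left sum.distrib act_add act_sum act_scale 1)
  qed
  show ?case
    unfolding expand[of A B] expand[of B A] Cons.IH[of "\<lambda>w. \<psi> (i # w)"]
    by (simp add: sum_subtractf left_diff_distrib)
qed simp

lemma act_tensor: "act A (tensor \<alpha> \<beta>) = (\<lambda>w. tensor (apply_mat A \<alpha>) \<beta> w + tensor \<alpha> (act A \<beta>) w)"
proof
  show "act A (tensor \<alpha> \<beta>) w = tensor (apply_mat A \<alpha>) \<beta> w + tensor \<alpha> (act A \<beta>) w" for w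
    by (cases w) (simp_all add: act_scale apply_mat_def sum_distrib_right mult.assoc)
qed

text \<open>The actions on the first letter and on the remaining word commute, so this is the
  binomial theorem for their sum.\<close>

lemma act_pow_tensor:
  "(act A ^^ n) (tensor \<alpha> \<beta>) =
    (\<lambda>w. \<Sum>k\<le>n. of_nat (n choose k) * tensor ((apply_mat A ^^ k) \<alpha>) ((act A ^^ (n - k)) \<beta>) w)"
proof (induction n)
  case (Suc n)
  let ?t = "\<lambda>k l w. tensor ((apply_mat A ^^ k) \<alpha>) ((act A ^^ l) \<beta>) w"
  have "(act A ^^ Suc n) (tensor \<alpha> \<beta>) = (\<lambda>w. \<Sum>k\<le>n. of_nat (n choose k) * (?t (Suc k) (n - k) w + ?t k (Suc (n - k)) w))"
    by (simp add: Suc.IH act_sum act_scale act_tensor)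
  also have "\<dots> = (\<lambda>w. \<Sum>k\<le>Suc n. of_nat (Suc n choose k) * ?t k (Suc n - k) w)"
  proof
    fix w
    have "(\<Sum>k\<le>Suc n. of_nat (Suc n choose k) * ?t k (Suc n - k) w)
        = ?t 0 (Suc n) w + (\<Sum>k\<le>n. of_nat (Suc n choose Suc k) * ?t (Suc k) (n - k) w)"
      by (simp add: sum.atMost_Suc_shift del: sum.atMost_Suc funpow.simps)
    also have "\<dots> = (\<Sum>k\<le>n. of_nat (n choose k) * ?t (Suc k) (n - k) w)
        + (?t 0 (Suc n) w + (\<Sum>k\<le>n. of_nat (n choose Suc k) * ?t (Suc k) (n - k) w))"
      by (simp add: distrib_right sum.distrib del: funpow.simps)
    also have "?t 0 (Suc n) w + (\<Sum>k\<le>n. of_nat (n choose Suc k) * ?t (Suc k) (n - k) w)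
        = (\<Sum>k\<le>Suc n. of_nat (n choose k) * ?t k (Suc n - k) w)"
      by (simp add: sum.atMost_Suc_shift del: sum.atMost_Suc funpow.simps)
    also have "\<dots> = (\<Sum>k\<le>n. of_nat (n choose k) * ?t k (Suc n - k) w)"
      by (simp del: funpow.simps)
    also have "\<dots> = (\<Sum>k\<le>n. of_nat (n choose k) * ?t k (Suc (n - k)) w)"
      by (intro sum.cong) (simp_all add: Suc_diff_le del: funpow.simps)
    finally show "(\<Sum>k\<le>n. of_nat (n choose k) * (?t (Suc k) (n - k) w + ?t k (Suc (n - k)) w))
        = (\<Sum>k\<le>Suc n. of_nat (Suc n choose k) * ?t k (Suc n - k) w)"
      by (simp add: distrib_left sum.distrib del: sum.atMost_Suc funpow.simps)
  qed
  finally show ?case .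
qed simp

lemma act_Reals: "(\<And>i j. A i j \<in> \<real>) \<Longrightarrow> (\<And>w. \<psi> w \<in> \<real>) \<Longrightarrow> act A \<psi> w \<in> \<real>"
  by (induction w arbitrary: \<psi>) (auto intro!: Reals_add sum_in_Reals Reals_mult)

section \<open>The bilinear form on words of fixed length\<close>

fun pairing :: "nat \<Rightarrow> ('a::finite list \<Rightarrow> complex) \<Rightarrow> ('a list \<Rightarrow> complex) \<Rightarrow> complex" where
  "pairing 0 \<psi> \<phi> = \<psi> [] * \<phi> []"
| "pairing (Suc n) \<psi> \<phi> = (\<Sum>i\<in>UNIV. pairing n (\<lambda>w. \<psi> (i # w)) (\<lambda>w. \<phi> (i # w)))"

lemma pairing_lincomb:
  "pairing n (\<lambda>w. c * \<psi> w + \<psi>' w) \<phi> = c * pairing n \<psi> \<phi> + pairing n \<psi>' \<phi>"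
  by (induction n arbitrary: \<psi> \<psi>' \<phi>) (simp_all add: sum.distrib sum_distrib_left distrib_right)

lemma pairing_commute: "pairing n \<psi> \<phi> = pairing n \<phi> \<psi>"
  by (induction n arbitrary: \<psi> \<phi>) (auto intro!: sum.cong)

lemma pairing_zero [simp]: "pairing n (\<lambda>w. 0) \<phi> = 0"
  by (induction n arbitrary: \<phi>) simp_all

lemma pairing_zero_right [simp]: "pairing n \<phi> (\<lambda>w. 0) = 0"
  using pairing_zero pairing_commute by metis

lemma pairing_sum: "pairing n (\<lambda>w. \<Sum>k\<in>K. c k * \<psi> k w) \<phi> = (\<Sum>k\<in>K. c k * pairing n (\<psi> k) \<phi>)"
  by (induction K rule: infinite_finite_induct) (simp_all add: pairing_lincomb)

text \<open>On each letter the matrix is moved across by transposition. For \<open>mat_f1\<close>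
  and \<open>mat_f2\<close> the transposes will be \<open>mat_e1\<close> and \<open>mat_e2\<close>,
  so raising and lowering operators are adjoint.\<close>

lemma pairing_act:
  "pairing n (act A \<psi>) \<phi> = pairing n \<psi> (act (\<lambda>i j. A j i) \<phi>)"
proof (induction n arbitrary: \<psi> \<phi>)
  case (Suc n)
  have l: "pairing n (\<lambda>w. (\<Sum>j\<in>UNIV. B j * \<alpha> j w) + \<beta> w) \<gamma>
     = (\<Sum>j\<in>UNIV. B j * pairing n (\<alpha> j) \<gamma>) + pairing n \<beta> \<gamma>" for B :: "'a \<Rightarrow> complex" and \<alpha> and \<beta> \<gamma> :: "'a list \<Rightarrow> complex"
    using pairing_lincomb[of n 1 "\<lambda>w. \<Sum>j\<in>UNIV. B j * \<alpha> j w" \<beta> \<gamma>] by (simp add: pairing_sum)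
  have r: "pairing n \<gamma> (\<lambda>w. (\<Sum>j\<in>UNIV. B j * \<alpha> j w) + \<beta> w)
     = (\<Sum>j\<in>UNIV. B j * pairing n \<gamma> (\<alpha> j)) + pairing n \<gamma> \<beta>" for B :: "'a \<Rightarrow> complex" and \<alpha> and \<beta> \<gamma> :: "'a list \<Rightarrow> complex"
    by (subst pairing_commute, subst l) (simp add: pairing_commute[of n \<gamma>])
  show ?case
    by (simp add: l r sum.distrib Suc.IH) (rule sum.swap)
qed simp

lemma pairing_act_pow:
  "pairing n ((act A ^^ k) \<psi>) \<phi> = pairing n \<psi> ((act (\<lambda>i j. A j i) ^^ k) \<phi>)"
proof (induction k arbitrary: \<phi>)
  case (Suc k)
  then show ?case
    unfolding funpow.simps o_apply pairing_act by (simp add: funpow_swap1)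
qed simp

lemma pairing_cnj_nonneg:
  "0 \<le> Re (pairing n (\<lambda>w. cnj (\<psi> w)) \<psi>)" "Im (pairing n (\<lambda>w. cnj (\<psi> w)) \<psi>) = 0"
  by (induction n arbitrary: \<psi>) (simp_all add: sum_nonneg)

text \<open>Conjugating one argument turns the form into a sum of squared moduli over the words of
  length \<open>n\<close>, so it is definite on each length.\<close>

lemma pairing_cnj_eq_0:
  "pairing n (\<lambda>w. cnj (\<psi> w)) \<psi> = 0 \<Longrightarrow> length w = n \<Longrightarrow> \<psi> w = 0"
proof (induction n arbitrary: \<psi> w)
  case (Suc n)
  obtain i w' where w: "w = i # w'" "length w' = n" using Suc.prems(2) by (cases w) auto
  let ?p = "\<lambda>i. pairing n (\<lambda>w. cnj (\<psi> (i # w))) (\<lambda>w. \<psi> (i # w))"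
  have "(\<Sum>i\<in>UNIV. Re (?p i)) = 0"
    using arg_cong[OF Suc.prems(1), of Re] by simp
  then have "Re (?p i) = 0"
    by (subst (asm) sum_nonneg_eq_0_iff) (simp_all add: pairing_cnj_nonneg)
  then have "?p i = 0"
    by (simp add: complex_eq_iff pairing_cnj_nonneg)
  then show ?case using Suc.IH[of "\<lambda>w. \<psi> (i # w)" w'] w by simp
qed simp

section \<open>The word model of sp4\<close>

text \<open>\<open>U\<^sub>i\<close> is the standard basis of \<open>\<complex>\<^sup>4\<close> and the \<open>P\<close> are the basis
  \<open>u\<^sub>1\<^sub>2, u\<^sub>1\<^sub>4, u\<^sub>2\<^sub>4, u\<^sub>1\<^sub>3, u\<^sub>2\<^sub>3, u\<^sub>3\<^sub>4\<close> of \<open>\<Lambda>\<^sup>2 \<complex>\<^sup>4\<close>, with signs chosen such that the matrices of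
  \<open>f\<^sub>1, f\<^sub>2\<close> have entries 0 and 1.\<close>

datatype idx = U1 | U2 | U3 | U4 | P1 | P2 | P3 | P3' | P4 | P5

lemma UNIV_idx: "UNIV = {U1, U2, U3, U4, P1, P2, P3, P3', P4, P5}"
proof -
  have "i \<in> {U1, U2, U3, U4, P1, P2, P3, P3', P4, P5}" for i by (cases i) simp_all
  then show ?thesis by blast
qed

instance idx :: finite
  by standard (simp add: UNIV_idx)

fun mat_f1 :: "idx \<Rightarrow> idx \<Rightarrow> complex" where
  "mat_f1 U2 U1 = 1" | "mat_f1 U3 U4 = 1"
| "mat_f1 P3 P2 = 1" | "mat_f1 P3' P2 = 1" | "mat_f1 P4 P3 = 1" | "mat_f1 P4 P3' = 1"
| "mat_f1 _ _ = 0"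

fun mat_f2 :: "idx \<Rightarrow> idx \<Rightarrow> complex" where
  "mat_f2 U4 U2 = 1" | "mat_f2 P2 P1 = 1" | "mat_f2 P5 P4 = 1" | "mat_f2 _ _ = 0"

definition mat_e1 :: "idx \<Rightarrow> idx \<Rightarrow> complex" where "mat_e1 i j = mat_f1 j i"
definition mat_e2 :: "idx \<Rightarrow> idx \<Rightarrow> complex" where "mat_e2 i j = mat_f2 j i"

fun diag_h1 :: "idx \<Rightarrow> complex" where
  "diag_h1 U1 = 1" | "diag_h1 U2 = -1" | "diag_h1 U3 = -1" | "diag_h1 U4 = 1"
| "diag_h1 P2 = 2" | "diag_h1 P4 = -2" | "diag_h1 _ = 0"

fun diag_h2 :: "idx \<Rightarrow> complex" where
  "diag_h2 U2 = 1" | "diag_h2 U4 = -1"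
| "diag_h2 P1 = 1" | "diag_h2 P2 = -1" | "diag_h2 P4 = 1" | "diag_h2 P5 = -1" | "diag_h2 _ = 0"

definition mat_h1 :: "idx \<Rightarrow> idx \<Rightarrow> complex" where "mat_h1 i j = (if i = j then diag_h1 i else 0)"
definition mat_h2 :: "idx \<Rightarrow> idx \<Rightarrow> complex" where "mat_h2 i j = (if i = j then diag_h2 i else 0)"

lemma act_mat_bracket:
  assumes "\<And>i k. (\<Sum>j\<in>UNIV. A i j * B j k - B i j * A j k) = C i k"
  shows "act A (act B \<psi>) = (\<lambda>w. act B (act A \<psi>) w + act C \<psi> w)"
  by (simp add: fun_eq_iff act_bracket[of A B] assms)

lemma act_scaled_mat: "act (\<lambda>i j. c * A i j) \<psi> w = c * act A \<psi> w"
  by (induction w arbitrary: \<psi>) (simp_all add: sum_distrib_left distrib_left mult.assoc)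

text \<open>Vanishing brackets are written as multiples by 0 so that \<open>act_scaled_mat\<close>
  rewrites them like the other scaled ones.\<close>

lemma mat_relations:
  "(\<Sum>j\<in>UNIV. mat_e1 i j * mat_f1 j k - mat_f1 i j * mat_e1 j k) = mat_h1 i k"
  "(\<Sum>j\<in>UNIV. mat_e2 i j * mat_f2 j k - mat_f2 i j * mat_e2 j k) = mat_h2 i k"
  "(\<Sum>j\<in>UNIV. mat_e1 i j * mat_f2 j k - mat_f2 i j * mat_e1 j k) = 0 * mat_h1 i k"
  "(\<Sum>j\<in>UNIV. mat_e2 i j * mat_f1 j k - mat_f1 i j * mat_e2 j k) = 0 * mat_h1 i k"
  "(\<Sum>j\<in>UNIV. mat_h1 i j * mat_f1 j k - mat_f1 i j * mat_h1 j k) = - 2 * mat_f1 i k"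
  "(\<Sum>j\<in>UNIV. mat_h1 i j * mat_f2 j k - mat_f2 i j * mat_h1 j k) = 2 * mat_f2 i k"
  "(\<Sum>j\<in>UNIV. mat_h2 i j * mat_f1 j k - mat_f1 i j * mat_h2 j k) = 1 * mat_f1 i k"
  "(\<Sum>j\<in>UNIV. mat_h2 i j * mat_f2 j k - mat_f2 i j * mat_h2 j k) = - 2 * mat_f2 i k"
  by (cases i; cases k; simp add: UNIV_idx mat_e1_def mat_e2_def mat_h1_def mat_h2_def)+

lemma act_mat_relations:
  "act mat_e1 (act mat_f1 \<psi>) = (\<lambda>w. act mat_f1 (act mat_e1 \<psi>) w + act mat_h1 \<psi> w)"
  "act mat_e2 (act mat_f2 \<psi>) = (\<lambda>w. act mat_f2 (act mat_e2 \<psi>) w + act mat_h2 \<psi> w)"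
  "act mat_e1 (act mat_f2 \<psi>) = act mat_f2 (act mat_e1 \<psi>)"
  "act mat_e2 (act mat_f1 \<psi>) = act mat_f1 (act mat_e2 \<psi>)"
  "act mat_h1 (act mat_f1 \<psi>) = (\<lambda>w. - 2 * act mat_f1 \<psi> w + act mat_f1 (act mat_h1 \<psi>) w)"
  "act mat_h1 (act mat_f2 \<psi>) = (\<lambda>w. 2 * act mat_f2 \<psi> w + act mat_f2 (act mat_h1 \<psi>) w)"
  "act mat_h2 (act mat_f1 \<psi>) = (\<lambda>w. 1 * act mat_f1 \<psi> w + act mat_f1 (act mat_h2 \<psi>) w)"
  "act mat_h2 (act mat_f2 \<psi>) = (\<lambda>w. - 2 * act mat_f2 \<psi> w + act mat_f2 (act mat_h2 \<psi>) w)"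
  using mat_relations[THEN act_mat_bracket, of \<psi>, unfolded act_scaled_mat]
  by (simp_all only: add.commute mult_zero_left add_0_left add_0_right)

definition delta :: "idx \<Rightarrow> idx \<Rightarrow> complex" where "delta k i = (if i = k then 1 else 0)"

lemma apply_mat_f1:
  "apply_mat mat_f1 \<alpha> = (\<lambda>i. case i of U2 \<Rightarrow> \<alpha> U1 | U3 \<Rightarrow> \<alpha> U4 | P3 \<Rightarrow> \<alpha> P2 | P3' \<Rightarrow> \<alpha> P2
     | P4 \<Rightarrow> \<alpha> P3 + \<alpha> P3' | _ \<Rightarrow> 0)"
proof
  show "apply_mat mat_f1 \<alpha> i = (case i of U2 \<Rightarrow> \<alpha> U1 | U3 \<Rightarrow> \<alpha> U4 | P3 \<Rightarrow> \<alpha> P2 | P3' \<Rightarrow> \<alpha> P2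
     | P4 \<Rightarrow> \<alpha> P3 + \<alpha> P3' | _ \<Rightarrow> 0)" for i
    by (cases i) (simp_all add: apply_mat_def UNIV_idx)
qed

lemma apply_mat_f2:
  "apply_mat mat_f2 \<alpha> = (\<lambda>i. case i of U4 \<Rightarrow> \<alpha> U2 | P2 \<Rightarrow> \<alpha> P1 | P5 \<Rightarrow> \<alpha> P4 | _ \<Rightarrow> 0)"
proof
  show "apply_mat mat_f2 \<alpha> i = (case i of U4 \<Rightarrow> \<alpha> U2 | P2 \<Rightarrow> \<alpha> P1 | P5 \<Rightarrow> \<alpha> P4 | _ \<Rightarrow> 0)" for i
    by (cases i) (simp_all add: apply_mat_def UNIV_idx)
qed

lemma apply_mat_f1_pow:
  "(apply_mat mat_f1 ^^ n) \<alpha> =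
    (if n = 0 then \<alpha> else if n = 1 then apply_mat mat_f1 \<alpha>
     else if n = 2 then (\<lambda>i. if i = P4 then 2 * \<alpha> P2 else 0) else (\<lambda>i. 0))"
proof -
  have 2: "(apply_mat mat_f1 ^^ 2) \<alpha> = (\<lambda>i. if i = P4 then 2 * \<alpha> P2 else 0)" for \<alpha>
    by (auto simp: numeral_2_eq_2 apply_mat_f1 fun_eq_iff split: idx.split)
  have z: "(apply_mat mat_f1 ^^ k) (\<lambda>i. 0) = (\<lambda>i. 0)" for k
    by (induction k) (auto simp: apply_mat_f1 fun_eq_iff split: idx.split)
  have 3: "(apply_mat mat_f1 ^^ (k + 1 + 2)) \<alpha> = (\<lambda>i. 0)" for k
  proof -
    have "apply_mat mat_f1 (\<lambda>i. if i = P4 then 2 * \<alpha> P2 else 0) = (\<lambda>i. 0)"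
      by (auto simp: apply_mat_f1 fun_eq_iff split: idx.split)
    then show ?thesis
      unfolding funpow_add o_apply 2 by (simp add: z)
  qed
  consider "n = 0" | "n = 1" | "n = 2" | "n = n - 3 + 1 + 2" by linarith
  then show ?thesis
  proof cases
    case 4
    then have "n \<noteq> 0" "n \<noteq> 1" "n \<noteq> 2" by linarith+
    then show ?thesis using 3[of "n - 3", folded 4] by simp
  qed (simp_all add: 2)
qed

lemma apply_mat_f2_pow:
  "(apply_mat mat_f2 ^^ n) \<alpha> =
    (if n = 0 then \<alpha> else if n = 1 then apply_mat mat_f2 \<alpha> else (\<lambda>i. 0))"
proof -
  have z: "(apply_mat mat_f2 ^^ k) (\<lambda>i. 0) = (\<lambda>i. 0)" for k
    by (induction k) (auto simp: apply_mat_f2 fun_eq_iff split: idx.split)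
  have 2: "apply_mat mat_f2 (apply_mat mat_f2 \<alpha>) = (\<lambda>i. 0)" for \<alpha>
    by (auto simp: apply_mat_f2 fun_eq_iff split: idx.split)
  have 3: "(apply_mat mat_f2 ^^ (k + 2)) \<alpha> = (\<lambda>i. 0)" for k
    unfolding funpow_add by (simp add: numeral_2_eq_2 2 z)
  consider "n = 0" | "n = 1" | "n = n - 2 + 2" by linarith
  then show ?thesis
  proof cases
    case 3
    then have "n \<noteq> 0" "n \<noteq> 1" by linarith+
    then show ?thesis using \<open>\<And>k. (apply_mat mat_f2 ^^ (k + 2)) \<alpha> = (\<lambda>i. 0)\<close>[of "n - 2", folded 3] by simp
  qed simp_all
qed

section \<open>Leading terms of the word coordinates\<close>

fun monomial_op :: "('v \<Rightarrow> 'v) \<Rightarrow> ('v \<Rightarrow> 'v) \<Rightarrow> nat \<times> nat \<times> nat \<times> nat \<Rightarrow> 'v \<Rightarrow> 'v" where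
  "monomial_op f g (a1, a2, a3, a4) u = (f ^^ a4) ((g ^^ a3) ((f ^^ a2) ((g ^^ a1) u)))"

fun source :: "idx \<Rightarrow> idx" where
  "source U1 = U1" | "source U2 = U1" | "source U3 = U1" | "source U4 = U1" | "source _ = P1"

text \<open>\<open>lead i\<close> is the exponent \<open>(a\<^sub>1, a\<^sub>2, a\<^sub>3, a\<^sub>4)\<close> of the leading term of the coordinate \<open>i\<close> of
  \<open>exp (s f\<^sub>1) exp (r f\<^sub>2) exp (t f\<^sub>1) exp (q f\<^sub>2)\<close> applied to the highest weight letter.\<close>

fun lead :: "idx \<Rightarrow> nat \<times> nat \<times> nat \<times> nat" where
  "lead U1 = (0,0,0,0)" | "lead U2 = (0,1,0,0)" | "lead U4 = (0,1,1,0)" | "lead U3 = (0,1,1,1)"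
| "lead P1 = (0,0,0,0)" | "lead P2 = (1,0,0,0)" | "lead P3 = (1,1,0,0)" | "lead P3' = (1,1,0,0)"
| "lead P4 = (1,2,0,0)" | "lead P5 = (1,2,1,0)"

text \<open>The degree in \<open>q\<close> and \<open>t\<close>, the variables belonging to
  \<open>a1\<close> and \<open>a2\<close>. In each letter coordinate a single monomial attains the
  maximum, so this degree alone singles out the leading term.\<close>

fun height12 :: "nat \<times> nat \<times> nat \<times> nat \<Rightarrow> nat" where
  "height12 (a1, a2, a3, a4) = a1 + a2"

lemma letter_coefficient:
  fixes i :: idx
  defines "S \<equiv> \<lambda>j. monomial_op (apply_mat mat_f1) (apply_mat mat_f2) j (delta (source i)) i"
  shows "S j \<noteq> 0 \<Longrightarrow> j = lead i \<or> height12 j < height12 (lead i)"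
    and "S (lead i) \<noteq> 0"
proof -
  obtain j1 j2 j3 j4 where j: "j = (j1, j2, j3, j4)" by (cases j)
  show "S (lead i) \<noteq> 0"
    unfolding S_def by (cases i)
      (simp_all add: apply_mat_f1_pow apply_mat_f2_pow apply_mat_f1 apply_mat_f2 delta_def)
  show "S j \<noteq> 0 \<Longrightarrow> j = lead i \<or> height12 j < height12 (lead i)"
    unfolding S_def j
    by (cases i)
      (auto simp: apply_mat_f1_pow apply_mat_f2_pow apply_mat_f1 apply_mat_f2 delta_def
         split: if_splits)
qed

definition word_delta :: "idx list \<Rightarrow> idx list \<Rightarrow> complex" where
  "word_delta w0 w = (if w = w0 then 1 else 0)"

lemma word_delta_Cons: "word_delta (k # w0) = tensor (delta k) (word_delta w0)"
proof
  show "word_delta (k # w0) w = tensor (delta k) (word_delta w0) w" for w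
    by (cases w) (simp_all add: word_delta_def delta_def)
qed

fun add4 :: "nat \<times> nat \<times> nat \<times> nat \<Rightarrow> nat \<times> nat \<times> nat \<times> nat \<Rightarrow> nat \<times> nat \<times> nat \<times> nat" where
  "add4 (a1, a2, a3, a4) (b1, b2, b3, b4) = (a1 + b1, a2 + b2, a3 + b3, a4 + b4)"

definition lead_word :: "idx list \<Rightarrow> nat \<times> nat \<times> nat \<times> nat" where
  "lead_word w = foldr (\<lambda>i. add4 (lead i)) w (0, 0, 0, 0)"

lemma lead_word_simps [simp]:
  "lead_word [] = (0, 0, 0, 0)" "lead_word (i # w) = add4 (lead i) (lead_word w)"
  by (simp_all add: lead_word_def)

abbreviation word_op :: "nat \<times> nat \<times> nat \<times> nat \<Rightarrow> (idx list \<Rightarrow> complex) \<Rightarrow> idx list \<Rightarrow> complex" where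
  "word_op \<equiv> monomial_op (act mat_f1) (act mat_f2)"

abbreviation letter_op :: "nat \<times> nat \<times> nat \<times> nat \<Rightarrow> (idx \<Rightarrow> complex) \<Rightarrow> idx \<Rightarrow> complex" where
  "letter_op \<equiv> monomial_op (apply_mat mat_f1) (apply_mat mat_f2)"

lemma act_pow_scale: "(act A ^^ n) (\<lambda>w. c * \<psi> w) = (\<lambda>w. c * (act A ^^ n) \<psi> w)"
  by (induction n) (simp_all add: act_scale)

lemma act_pow_sum: "(act A ^^ n) (\<lambda>w. \<Sum>k\<in>K. \<psi> k w) = (\<lambda>w. \<Sum>k\<in>K. (act A ^^ n) (\<psi> k) w)"
  by (induction n) (simp_all add: act_sum)

text \<open>Up to factorials, the generating series of the coordinates is multiplicative over the
  letters of a word. Leading exponents therefore add up, as in \<open>lead_word\<close>.\<close>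

lemma word_op_tensor:
  "word_op (a1, a2, a3, a4) (tensor \<alpha> \<beta>) (i # w) =
    (\<Sum>j1\<le>a1. \<Sum>j2\<le>a2. \<Sum>j3\<le>a3. \<Sum>j4\<le>a4.
      of_nat ((a1 choose j1) * (a2 choose j2) * (a3 choose j3) * (a4 choose j4)) *
      (letter_op (j1, j2, j3, j4) \<alpha> i * word_op (a1 - j1, a2 - j2, a3 - j3, a4 - j4) \<beta> w))"
  by (simp add: act_pow_tensor act_pow_sum act_pow_scale sum_distrib_left mult.assoc)

lemma height12_add4: "height12 (add4 a b) = height12 a + height12 b"
  by (cases a; cases b) simp

text \<open>A nonzero summand of the convolution splits \<open>a\<close> into a letter part and a
  remainder. Since \<open>height12\<close> is additive, falling short in either part makes the whole
  fall short.\<close>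

lemma word_coefficient_nonzero:
  "word_op a (word_delta (map source w)) w \<noteq> 0 \<Longrightarrow>
    a = lead_word w \<or> height12 a < height12 (lead_word w)"
proof (induction w arbitrary: a)
  case Nil
  obtain a1 a2 a3 a4 where a: "a = (a1, a2, a3, a4)" by (cases a)
  have "(act A ^^ Suc k) \<psi> [] = 0" for A :: "idx \<Rightarrow> idx \<Rightarrow> complex" and k \<psi> by simp
  then have nil: "(act A ^^ k) \<psi> [] = (if k = 0 then \<psi> [] else 0)"
    for A :: "idx \<Rightarrow> idx \<Rightarrow> complex" and k \<psi> by (cases k) auto
  show ?case using Nil by (auto simp: a nil split: if_splits)
next
  case (Cons i w)
  obtain a1 a2 a3 a4 where a: "a = (a1, a2, a3, a4)" by (cases a)
  let ?c = "\<lambda>j1 j2 j3 j4. of_nat ((a1 choose j1) * (a2 choose j2) * (a3 choose j3) * (a4 choose j4)) *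
      (letter_op (j1, j2, j3, j4) (delta (source i)) i *
       word_op (a1 - j1, a2 - j2, a3 - j3, a4 - j4) (word_delta (map source w)) w)"
  have "(\<Sum>j1\<le>a1. \<Sum>j2\<le>a2. \<Sum>j3\<le>a3. \<Sum>j4\<le>a4. ?c j1 j2 j3 j4) \<noteq> 0"
    using Cons.prems unfolding a list.map word_delta_Cons word_op_tensor .
  then obtain j1 where j1: "j1 \<le> a1" "(\<Sum>j2\<le>a2. \<Sum>j3\<le>a3. \<Sum>j4\<le>a4. ?c j1 j2 j3 j4) \<noteq> 0"
    by (meson atMost_iff sum.not_neutral_contains_not_neutral)
  then obtain j2 where j2: "j2 \<le> a2" "(\<Sum>j3\<le>a3. \<Sum>j4\<le>a4. ?c j1 j2 j3 j4) \<noteq> 0"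
    by (meson atMost_iff sum.not_neutral_contains_not_neutral)
  then obtain j3 where j3: "j3 \<le> a3" "(\<Sum>j4\<le>a4. ?c j1 j2 j3 j4) \<noteq> 0"
    by (meson atMost_iff sum.not_neutral_contains_not_neutral)
  then obtain j4 where j4: "j4 \<le> a4" "?c j1 j2 j3 j4 \<noteq> 0"
    by (meson atMost_iff sum.not_neutral_contains_not_neutral)
  let ?j = "(j1, j2, j3, j4)" and ?r = "(a1 - j1, a2 - j2, a3 - j3, a4 - j4)"
  have nz: "letter_op ?j (delta (source i)) i \<noteq> 0" "word_op ?r (word_delta (map source w)) w \<noteq> 0"
    using j4(2) by (metis mult_zero_left mult_zero_right)+
  have split: "a = add4 ?j ?r" using j1 j2 j3 j4 a by simp
  have "?j = lead i \<or> height12 ?j < height12 (lead i)" by (rule letter_coefficient(1)[OF nz(1)])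
  moreover have "?r = lead_word w \<or> height12 ?r < height12 (lead_word w)" by (rule Cons.IH[OF nz(2)])
  ultimately show ?case
    unfolding split lead_word_simps height12_add4 by (metis add_less_cancel_left add_less_cancel_right add_strict_mono)
qed

text \<open>Only the splitting into \<open>lead i\<close> and \<open>lead_word w\<close> survives in
  the convolution: any other letter part loses height, and the remainder cannot exceed the height of
  \<open>lead_word w\<close> to make up for it.\<close>

lemma word_coefficient_lead:
  "word_op (lead_word w) (word_delta (map source w)) w \<noteq> 0"
proof (induction w)
  case Nil
  show ?case by (simp add: word_delta_def)
next
  case (Cons i w)
  obtain l1 l2 l3 l4 where l: "lead i = (l1, l2, l3, l4)" by (cases "lead i")
  obtain b1 b2 b3 b4 where b: "lead_word w = (b1, b2, b3, b4)" by (cases "lead_word w")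
  let ?c = "\<lambda>j1 j2 j3 j4. of_nat ((l1 + b1 choose j1) * (l2 + b2 choose j2) * (l3 + b3 choose j3) * (l4 + b4 choose j4)) *
      (letter_op (j1, j2, j3, j4) (delta (source i)) i *
       word_op (l1 + b1 - j1, l2 + b2 - j2, l3 + b3 - j3, l4 + b4 - j4) (word_delta (map source w)) w) :: complex"
  have zero: "?c j1 j2 j3 j4 = 0"
    if "(j1, j2, j3, j4) \<noteq> lead i" "j1 \<le> l1 + b1" "j2 \<le> l2 + b2" "j3 \<le> l3 + b3" "j4 \<le> l4 + b4"
    for j1 j2 j3 j4
  proof (rule ccontr)
    let ?j = "(j1, j2, j3, j4)" and ?r = "(l1 + b1 - j1, l2 + b2 - j2, l3 + b3 - j3, l4 + b4 - j4)"
    assume "?c j1 j2 j3 j4 \<noteq> 0"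
    then have nz: "letter_op ?j (delta (source i)) i \<noteq> 0" "word_op ?r (word_delta (map source w)) w \<noteq> 0"
      by (metis mult_zero_left mult_zero_right)+
    have "height12 ?j < height12 (lead i)" using letter_coefficient(1)[OF nz(1)] that(1) by blast
    moreover have "height12 ?r \<le> height12 (lead_word w)"
      using word_coefficient_nonzero[OF nz(2)] by (metis less_imp_le order_refl)
    ultimately show False using that by (simp add: l b)
  qed
  have pick: "(\<Sum>j\<le>n. g j) = g m" if "m \<le> n" "\<And>j. j \<le> n \<Longrightarrow> j \<noteq> m \<Longrightarrow> g j = 0"
    for g :: "nat \<Rightarrow> complex" and m n
    using that by (subst sum.remove[of _ m]) (auto intro!: sum.neutral)
  have "word_op (lead_word (i # w)) (word_delta (map source (i # w))) (i # w) =
      (\<Sum>j1\<le>l1 + b1. \<Sum>j2\<le>l2 + b2. \<Sum>j3\<le>l3 + b3. \<Sum>j4\<le>l4 + b4. ?c j1 j2 j3 j4)"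
    unfolding lead_word_simps l b add4.simps list.map word_delta_Cons word_op_tensor ..
  also have "\<dots> = (\<Sum>j2\<le>l2 + b2. \<Sum>j3\<le>l3 + b3. \<Sum>j4\<le>l4 + b4. ?c l1 j2 j3 j4)"
    by (intro pick sum.neutral ballI zero) (auto simp: l)
  also have "\<dots> = (\<Sum>j3\<le>l3 + b3. \<Sum>j4\<le>l4 + b4. ?c l1 l2 j3 j4)"
    by (intro pick sum.neutral ballI zero) (auto simp: l)
  also have "\<dots> = (\<Sum>j4\<le>l4 + b4. ?c l1 l2 l3 j4)"
    by (intro pick sum.neutral ballI zero) (auto simp: l)
  also have "\<dots> = ?c l1 l2 l3 l4"
    by (intro pick zero) (auto simp: l)
  also have "\<dots> \<noteq> 0"
    using letter_coefficient(2)[of i] Cons.IH by (simp add: l b)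
  finally show ?case .
qed

section \<open>The exponents of F as leading exponents\<close>

definition admissible :: "nat \<Rightarrow> nat \<Rightarrow> (nat \<times> nat \<times> nat \<times> nat) set" where
  "admissible m1 m2 = {(a1, a2, a3, a4). a1 \<le> m2 \<and> a2 \<le> m1 + 2 * a1 \<and>
     a3 \<le> a2 \<and> 2 * a3 \<le> a2 + m1 \<and> a4 \<le> m1 \<and> a4 \<le> a3}"

lemma lead_word_append: "lead_word (u @ w) = add4 (lead_word u) (lead_word w)"
proof -
  have "add4 (add4 a b) c = add4 a (add4 b c)" for a b c by (cases a; cases b; cases c) simp
  moreover have "add4 (0, 0, 0, 0) a = a" for a by (cases a) simp
  ultimately show ?thesis by (induction u) simp_all
qed

lemma lead_word_replicate:
  "lead i = (l1, l2, l3, l4) \<Longrightarrow> lead_word (replicate n i) = (n * l1, n * l2, n * l3, n * l4)"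
  by (induction n) simp_all

text \<open>The numbers \<open>k1, ..., k4\<close> count the letters \<open>U1, U2, U4, U3\<close>,
  and \<open>n1, ..., n5\<close> count \<open>P1, P2, P3, P4, P5\<close>; the equations say that the
  leads of these letters sum to the given exponent.\<close>

lemma admissible_decomposition:
  assumes "(a1, a2, a3, a4) \<in> admissible m1 m2"
  shows "\<exists>k1 k2 k3 k4 n1 n2 n3 n4 n5. k1 + k2 + k3 + k4 = m1 \<and> n1 + n2 + n3 + n4 + n5 = m2 \<and>
    a1 = n2 + n3 + n4 + n5 \<and> a2 = k2 + k3 + k4 + n3 + 2 * n4 + 2 * n5 \<and> a3 = k3 + k4 + n5 \<and> a4 = k4"
proof -
  \<comment> \<open>The choice is greedy. As much of \<open>a3\<close> as possible goes to the
    \<open>c\<close> letters \<open>U4\<close> and \<open>U3\<close>, the excess to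
    \<open>P5\<close>. What is then left of \<open>a2\<close> goes first to \<open>U2\<close>, then
    in pairs to \<open>P4\<close>, with at most one \<open>P3\<close> for the parity.\<close>
  define c where "c = min m1 a3"
  define n5 where "n5 = a3 - c"
  define rest where "rest = a2 - (c + 2 * n5)"
  define k2 where "k2 = min rest (m1 - c)"
  define n4 where "n4 = (rest - k2) div 2"
  define n3 where "n3 = (rest - k2) mod 2"
  have bounds: "a1 \<le> m2" "a2 \<le> m1 + 2 * a1" "a3 \<le> a2" "2 * a3 \<le> a2 + m1" "a4 \<le> m1" "a4 \<le> a3"
    using assms by (auto simp: admissible_def)
  have le: "c + 2 * n5 \<le> a2" "a4 \<le> c" "c \<le> m1"
    using bounds by (auto simp: c_def n5_def)
  have rest: "rest - k2 = n3 + 2 * n4" "n3 \<le> 1" "k2 \<le> rest" "k2 \<le> m1 - c"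
    by (auto simp: n3_def n4_def k2_def)
  \<comment> \<open>If the letters \<open>U2\<close> absorb all of \<open>rest\<close>, only
    \<open>n5\<close> remains, bounded through \<open>2 * a3\<close>. Otherwise
    \<open>n3 + 2 * n4 + 2 * n5 = a2 - m1\<close> is at most \<open>2 * a1\<close>, and parity takes
    care of \<open>n3\<close>.\<close>
  have a1: "n3 + n4 + n5 \<le> a1"
  proof (cases "rest \<le> m1 - c")
    case True
    then have "n3 = 0" "n4 = 0" by (auto simp: n3_def n4_def k2_def)
    then show ?thesis using bounds unfolding n5_def c_def by linarith
  next
    case False
    then have "k2 = m1 - c" by (simp add: k2_def)
    then have "n3 + 2 * n4 + 2 * n5 + m1 = a2" using rest le False unfolding rest_def by linarith
    then show ?thesis using bounds rest by linarith
  qed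
  have eqs: "n5 + c = a3" "k2 + n3 + 2 * n4 + c + 2 * n5 = a2"
  proof -
    show "n5 + c = a3" by (simp add: n5_def c_def)
    have "rest + (c + 2 * n5) = a2" using le(1) by (simp add: rest_def)
    then show "k2 + n3 + 2 * n4 + c + 2 * n5 = a2" using rest(1,3) by linarith
  qed
  show ?thesis
    by (rule exI[of _ "m1 - c - k2"], rule exI[of _ k2], rule exI[of _ "c - a4"], rule exI[of _ a4],
        rule exI[of _ "m2 - a1"], rule exI[of _ "a1 - n3 - n4 - n5"], rule exI[of _ n3],
        rule exI[of _ n4], rule exI[of _ n5])
      (use eqs bounds(1) le rest(4) a1 in \<open>intro conjI; linarith\<close>)
qed

abbreviation start_word :: "nat \<Rightarrow> nat \<Rightarrow> idx list" where
  "start_word m1 m2 \<equiv> replicate m1 U1 @ replicate m2 P1"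

lemma admissible_lead_word:
  assumes "a \<in> admissible m1 m2"
  obtains w where "map source w = start_word m1 m2" "lead_word w = a"
proof -
  obtain a1 a2 a3 a4 where a: "a = (a1, a2, a3, a4)" by (cases a)
  obtain k1 k2 k3 k4 n1 n2 n3 n4 n5 where d: "k1 + k2 + k3 + k4 = m1" "n1 + n2 + n3 + n4 + n5 = m2"
    "a1 = n2 + n3 + n4 + n5" "a2 = k2 + k3 + k4 + n3 + 2 * n4 + 2 * n5" "a3 = k3 + k4 + n5" "a4 = k4"
    using admissible_decomposition assms unfolding a by metis
  let ?w = "replicate k1 U1 @ replicate k2 U2 @ replicate k3 U4 @ replicate k4 U3 @
    replicate n1 P1 @ replicate n2 P2 @ replicate n3 P3 @ replicate n4 P4 @ replicate n5 P5"
  show ?thesis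
  proof
    show "map source ?w = start_word m1 m2"
      by (simp add: d(1,2)[symmetric] replicate_add)
    show "lead_word ?w = a"
      by (simp add: a d lead_word_append lead_word_replicate[OF lead.simps(1)]
        lead_word_replicate[OF lead.simps(2)] lead_word_replicate[OF lead.simps(3)]
        lead_word_replicate[OF lead.simps(4)] lead_word_replicate[OF lead.simps(5)]
        lead_word_replicate[OF lead.simps(6)] lead_word_replicate[OF lead.simps(7)]
        lead_word_replicate[OF lead.simps(9)] lead_word_replicate[OF lead.simps(10)])
  qed
qed

text \<open>Eigenvalues of letters add under a derivation; the case \<open>d k = 0\<close> covers
  letters killed by \<open>A\<close>.\<close>

lemma act_word_delta:
  assumes "\<And>k. k \<in> set w0 \<Longrightarrow> apply_mat A (delta k) = (\<lambda>i. d k * delta k i)"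
  shows "act A (word_delta w0) = (\<lambda>w. (\<Sum>k\<leftarrow>w0. d k) * word_delta w0 w)"
  using assms
proof (induction w0)
  case Nil
  show ?case
  proof
    show "act A (word_delta []) w = (\<Sum>k\<leftarrow>[]. d k) * word_delta [] w" for w
    proof (cases w)
      case (Cons i v)
      then show ?thesis using act_zero[of A] by (simp add: word_delta_def)
    qed simp
  qed
next
  case (Cons k w0)
  have "tensor (\<lambda>i. c * \<alpha> i) \<beta> w + tensor \<alpha> (\<lambda>w. s * \<beta> w) w = (c + s) * tensor \<alpha> \<beta> w"
    for c s \<alpha> \<beta> and w :: "idx list" by (cases w) (simp_all add: algebra_simps)
  then show ?case using Cons by (simp add: word_delta_Cons act_tensor)
qed

lemma start_word_hw:
  fixes m1 m2 :: nat
  defines "m \<equiv> word_delta (start_word m1 m2)"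
  shows "act mat_e1 m = (\<lambda>w. 0)" "act mat_e2 m = (\<lambda>w. 0)"
    "act mat_h1 m = (\<lambda>w. of_nat m1 * m w)" "act mat_h2 m = (\<lambda>w. of_nat m2 * m w)"
proof -
  have e: "apply_mat mat_e1 (delta k) = (\<lambda>i. 0 * delta k i)" "apply_mat mat_e2 (delta k) = (\<lambda>i. 0 * delta k i)"
    if "k \<in> set (start_word m1 m2)" for k
    using that by (auto simp: fun_eq_iff apply_mat_def UNIV_idx delta_def mat_e1_def mat_e2_def
        split: if_splits)
  have h: "apply_mat mat_h1 (delta k) = (\<lambda>i. diag_h1 k * delta k i)" 
    "apply_mat mat_h2 (delta k) = (\<lambda>i. diag_h2 k * delta k i)" for k
    by (cases k; simp add: fun_eq_iff apply_mat_def UNIV_idx delta_def mat_h1_def mat_h2_def)+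
  show "act mat_e1 m = (\<lambda>w. 0)" "act mat_e2 m = (\<lambda>w. 0)"
    unfolding m_def using act_word_delta[of "start_word m1 m2" _ "\<lambda>_. 0", OF e(1)]
      act_word_delta[of "start_word m1 m2" _ "\<lambda>_. 0", OF e(2)] by (simp_all add: sum_list_replicate)
  show "act mat_h1 m = (\<lambda>w. of_nat m1 * m w)" "act mat_h2 m = (\<lambda>w. of_nat m2 * m w)"
    unfolding m_def act_word_delta[OF h(1)] act_word_delta[OF h(2)]
    by (simp_all add: map_replicate_const sum_list_replicate)
qed

section \<open>Highest weight modules\<close>

no_notation vector_scalar_mult (infixl "*s" 70)

text \<open>The vectors may be zero, so this splits a vanishing sum into its homogeneous components.
  Applying \<open>D\<close> and subtracting \<open>\<mu> l\<close> times the relation removes the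
  term at \<open>l\<close> and rescales the others by nonzero factors.\<close>

lemma (in vector_space) eigenvectors_sum_zero:
  assumes "Vector_Spaces.linear scale scale D" and "finite K" and "inj_on \<mu> K"
    and "\<And>k. k \<in> K \<Longrightarrow> D (x k) = \<mu> k *s x k" and "(\<Sum>k\<in>K. x k) = 0" and "k \<in> K"
  shows "x k = 0"
  using assms(2-6)
proof (induction K arbitrary: x k rule: finite_induct)
  case (insert l K)
  interpret D: Vector_Spaces.linear scale scale D by (rule assms(1))
  have "D (x l) + (\<Sum>k\<in>K. D (x k)) = 0"
    using arg_cong[OF insert.prems(3), of D] insert.hyps by (simp add: D.add D.sum)
  moreover have "\<mu> l *s x l + (\<Sum>k\<in>K. \<mu> l *s x k) = 0"
    using arg_cong[OF insert.prems(3), of "scale (\<mu> l)"] insert.hyps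
    by (simp add: scale_right_distrib scale_sum_right)
  ultimately have "(\<Sum>k\<in>K. (\<mu> k - \<mu> l) *s x k) = 0"
    using insert.prems(2) by (simp add: scale_left_diff_distrib sum_subtractf) (metis (no_types, lifting) add_left_cancel)
  then have "(\<mu> k - \<mu> l) *s x k = 0" if "k \<in> K" for k
    using insert.IH[of "\<lambda>k. (\<mu> k - \<mu> l) *s x k" k] insert.prems(1,2) that
    by (simp add: D.scale scale_left_commute)
  moreover have "\<mu> k \<noteq> \<mu> l" if "k \<in> K" for k
    using insert.prems(1) insert.hyps that by (auto simp: inj_on_def)
  ultimately have "x k = 0" if "k \<in> K" for k using that by auto
  then show ?case using insert by auto
qed simp

lemma (in vector_space) finite_eigenvalues:
  assumes "Vector_Spaces.linear scale scale D" and B: "finite B" "span B = UNIV"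
  shows "finite {\<mu>. \<exists>x. x \<noteq> 0 \<and> D x = \<mu> *s x}" (is "finite ?M")
proof (rule ccontr)
  assume "infinite ?M"
  from infinite_arbitrarily_large[OF this, of "Suc (card B)"]
  obtain K where K: "K \<subseteq> ?M" "finite K" "card K = Suc (card B)" by blast
  then have "\<forall>\<mu>\<in>K. \<exists>x. x \<noteq> 0 \<and> D x = \<mu> *s x" by blast
  from bchoice[OF this] obtain x
    where x: "\<And>\<mu>. \<mu> \<in> K \<Longrightarrow> x \<mu> \<noteq> 0" "\<And>\<mu>. \<mu> \<in> K \<Longrightarrow> D (x \<mu>) = \<mu> *s x \<mu>" by blast
  interpret D: Vector_Spaces.linear scale scale D by (rule assms(1))
  have inj: "inj_on x K"
  proof (rule inj_onI)
    fix \<mu> \<nu> assume "\<mu> \<in> K" "\<nu> \<in> K" "x \<mu> = x \<nu>"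
    then have "\<mu> *s x \<mu> = \<nu> *s x \<mu>" using x(2) by metis
    then show "\<mu> = \<nu>" using x(1) \<open>\<mu> \<in> K\<close> by simp
  qed
  have "independent (x ` K)"
  proof (rule independent_if_scalars_zero)
    fix f y
    assume sum: "(\<Sum>y\<in>x ` K. f y *s y) = 0" and "y \<in> x ` K"
    then obtain k where k: "k \<in> K" "y = x k" by blast
    have "f (x k) *s x k = 0"
      using sum k x inj K(2) D.scale
      by (intro eigenvectors_sum_zero[OF assms(1), of K "\<lambda>k. k" "\<lambda>k. f (x k) *s x k"])
        (auto simp: sum.reindex scale_left_commute)
    then show "f y = 0" using k x by simp
  qed (use K in simp)
  then have "card (x ` K) \<le> card B"
    using independent_span_bound[OF B(1)] B(2) by simp
  then show False using K inj by (simp add: card_image)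
qed

lemma (in vector_space) span_linear_into:
  assumes "Vector_Spaces.linear scale scale f" and "\<And>u. u \<in> A \<Longrightarrow> f u \<in> span A" and "u \<in> span A"
  shows "f u \<in> span A"
proof -
  interpret f: Vector_Spaces.linear scale scale f by (rule assms(1))
  show ?thesis
    using assms(3)
    by (induction rule: span_induct_alt) (auto simp: f.add f.scale intro: span_zero span_add span_scale assms(2))
qed

text \<open>Moving \<open>e\<close> past the copies of \<open>f\<close> collects the weights
  \<open>c - 2 j\<close> for \<open>j = 0, ..., k\<close>, whose sum is
  \<open>(k + 1) (c - k)\<close>.\<close>

lemma (in vector_space) sl2_highest_weight_string:
  assumes "Vector_Spaces.linear scale scale e" "Vector_Spaces.linear scale scale f"
    "Vector_Spaces.linear scale scale h"
    and ef: "\<And>u. e (f u) = f (e u) + h u" and hf: "\<And>u. h (f u) = f (h u) - 2 *s f u"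
    and u: "e u = 0" "h u = c *s u"
  shows "h ((f ^^ k) u) = (c - 2 * of_nat k) *s (f ^^ k) u"
    and "e ((f ^^ Suc k) u) = (of_nat (Suc k) * (c - of_nat k)) *s (f ^^ k) u"
proof -
  interpret e: Vector_Spaces.linear scale scale e by (rule assms)
  interpret f: Vector_Spaces.linear scale scale f by (rule assms)
  interpret h: Vector_Spaces.linear scale scale h by (rule assms)
  show h: "h ((f ^^ k) u) = (c - 2 * of_nat k) *s (f ^^ k) u" for k
  proof (induction k)
    case (Suc k)
    have "h ((f ^^ Suc k) u) = ((c - 2 * of_nat k) - 2) *s (f ^^ Suc k) u"
      unfolding funpow.simps o_apply hf Suc f.scale by (simp only: scale_left_diff_distrib)
    then show ?case by (simp add: algebra_simps)
  qed (simp add: u)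
  show "e ((f ^^ Suc k) u) = (of_nat (Suc k) * (c - of_nat k)) *s (f ^^ k) u"
  proof (induction k)
    case 0
    show ?case by (simp add: ef u)
  next
    case (Suc k)
    have "e ((f ^^ Suc (Suc k)) u) = f (e ((f ^^ Suc k) u)) + h ((f ^^ Suc k) u)"
      by (simp add: ef)
    also have "\<dots> = (of_nat (Suc k) * (c - of_nat k) + (c - 2 * of_nat (Suc k))) *s (f ^^ Suc k) u"
      unfolding Suc.IH h f.scale by (simp add: scale_left_distrib)
    also have "of_nat (Suc k) * (c - of_nat k) + (c - 2 * of_nat (Suc k))
        = of_nat (Suc (Suc k)) * (c - of_nat (Suc k))"
      by (simp add: algebra_simps)
    finally show ?case .
  qed
qed


locale complex_vector_space = vector_space scale
  for scale :: "complex \<Rightarrow> 'v::ab_group_add \<Rightarrow> 'v" (infixr "*s" 75)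
begin

text \<open>Let \<open>(f ^^ n) u\<close> be the last nonzero vector of the string. Applying
  \<open>e\<close> to the next one shows that \<open>(n + 1) (c - n)\<close> vanishes.\<close>

lemma sl2_integral_highest_weight:
  assumes e: "Vector_Spaces.linear scale scale e" and f: "Vector_Spaces.linear scale scale f"
    and h: "Vector_Spaces.linear scale scale h"
    and ef: "\<And>u. e (f u) = f (e u) + h u" and hf: "\<And>u. h (f u) = f (h u) - 2 *s f u"
    and u: "e u = 0" "h u = c *s u" "u \<noteq> 0" and nilpotent: "\<exists>k. (f ^^ k) u = 0"
  obtains n where "c = of_nat n" "(f ^^ Suc n) u = 0"
proof -
  define k where "k = (LEAST k. (f ^^ k) u = 0)"
  have k: "(f ^^ k) u = 0" unfolding k_def using nilpotent by (rule LeastI_ex)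
  have "k \<noteq> 0" using k u(3) by (metis funpow_0)
  then obtain n where n: "k = Suc n" using not0_implies_Suc by blast
  have "(f ^^ n) u \<noteq> 0" using not_less_Least[of n "\<lambda>k. (f ^^ k) u = 0"] n unfolding k_def by simp
  moreover have e0: "e 0 = 0"
    using e module_hom.zero module_hom_iff_linear by blast
  have "(of_nat (Suc n) * (c - of_nat n)) *s (f ^^ n) u = 0"
    using sl2_highest_weight_string(2)[OF e f h ef hf u(1,2), of n] k n e0 by simp
  ultimately have "c = of_nat n"
    using of_nat_neq_0[of n, where 'a = complex] by simp
  then show ?thesis using that k n by blast
qed

end


section \<open>Modules over the Chevalley generators\<close>

locale chevalley_module = complex_vector_space scale +
  E1: Vector_Spaces.linear scale scale E1 + E2: Vector_Spaces.linear scale scale E2 +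
  F1: Vector_Spaces.linear scale scale F1 + F2: Vector_Spaces.linear scale scale F2 +
  H1: Vector_Spaces.linear scale scale H1 + H2: Vector_Spaces.linear scale scale H2
  for scale :: "complex \<Rightarrow> 'v::ab_group_add \<Rightarrow> 'v" (infixr "*s" 75)
    and E1 E2 F1 F2 H1 H2 :: "'v \<Rightarrow> 'v" +
  assumes E1_F1: "E1 (F1 u) = F1 (E1 u) + H1 u" and E2_F2: "E2 (F2 u) = F2 (E2 u) + H2 u"
    and E1_F2: "E1 (F2 u) = F2 (E1 u)" and E2_F1: "E2 (F1 u) = F1 (E2 u)"
    and H1_F1: "H1 (F1 u) = F1 (H1 u) - 2 *s F1 u" and H1_F2: "H1 (F2 u) = F2 (H1 u) + 2 *s F2 u"
    and H2_F1: "H2 (F1 u) = F1 (H2 u) + F1 u" and H2_F2: "H2 (F2 u) = F2 (H2 u) - 2 *s F2 u"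
    and H1_E1: "H1 (E1 u) = E1 (H1 u) + 2 *s E1 u" and H1_E2: "H1 (E2 u) = E2 (H1 u) - 2 *s E2 u"
    and H2_E1: "H2 (E1 u) = E1 (H2 u) - E1 u" and H2_E2: "H2 (E2 u) = E2 (H2 u) + 2 *s E2 u"
begin

text \<open>Through this symmetry, results on highest weight vectors are reused for lowest weight
  vectors.\<close>

lemma chevalley_involution:
  "chevalley_module scale F1 F2 E1 E2 (\<lambda>u. - H1 u) (\<lambda>u. - H2 u)"
proof -
  have "Vector_Spaces.linear scale scale (\<lambda>u. - H1 u)" "Vector_Spaces.linear scale scale (\<lambda>u. - H2 u)"
    using H1.linear_axioms H2.linear_axioms by (simp_all add: Vector_Spaces.linear_iff)
  then show ?thesis
    by (intro chevalley_module.intro complex_vector_space.intro chevalley_module_axioms.intro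
        E1.linear_axioms E2.linear_axioms F1.linear_axioms F2.linear_axioms vector_space_axioms)
      (simp_all add: E1_F1 E2_F2 E1_F2 E2_F1 H1_F1 H1_F2 H2_F1 H2_F2 H1_E1 H1_E2 H2_E1 H2_E2
        E1.neg E2.neg F1.neg F2.neg)
qed

text \<open>The element of the Cartan subalgebra on which both simple roots take the value 1.\<close>

definition grading :: "'v \<Rightarrow> 'v" where
  "grading u = (3/2) *s H1 u + 2 *s H2 u"

lemma linear_grading: "Vector_Spaces.linear scale scale grading"
  unfolding Vector_Spaces.linear_iff
  by (intro conjI vector_space_axioms allI)
    (simp_all add: grading_def H1.add H2.add H1.scale H2.scale scale_right_distrib mult.commute)

lemma grading_F: "grading (F1 u) = F1 (grading u) - F1 u" "grading (F2 u) = F2 (grading u) - F2 u"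
proof -
  have shuffle: "A - (B + b) + (C + B) = (A + C) - b" "A + (B + b) + (C - (B + b + b)) = (A + C) - b"
    for A B C b :: 'v by simp_all
  have three: "3 *s b = 2 *s b + b" "4 *s b = 2 *s b + b + b" for b
    using scale_left_distrib[of 2 1 b] scale_left_distrib[of 3 1 b] by simp_all
  have "(3/2) *s (a - 2 *s b) + 2 *s (c + b) = ((3/2) *s a - 3 *s b) + (2 *s c + 2 *s b)" for a b c
    by (simp add: scale_right_distrib scale_right_diff_distrib)
  then show "grading (F1 u) = F1 (grading u) - F1 u"
    by (simp only: grading_def H1_F1 H2_F1 F1.add F1.scale three shuffle)
  have "(3/2) *s (a + 2 *s b) + 2 *s (c - 2 *s b) = ((3/2) *s a + 3 *s b) + (2 *s c - 4 *s b)" for a b c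
    by (simp add: scale_right_distrib scale_right_diff_distrib)
  then show "grading (F2 u) = F2 (grading u) - F2 u"
    by (simp only: grading_def H1_F2 H2_F2 F2.add F2.scale three shuffle)
qed

lemma grading_F_pow:
  assumes "grading u = \<mu> *s u"
  shows "grading ((F1 ^^ n) u) = (\<mu> - of_nat n) *s (F1 ^^ n) u"
    and "grading ((F2 ^^ n) u) = (\<mu> - of_nat n) *s (F2 ^^ n) u"
proof -
  have step: "f (c *s u) - f u = (c - 1) *s f u" if "Vector_Spaces.linear scale scale f" for f c u
    using that by (simp add: Vector_Spaces.linear_iff scale_left_diff_distrib)
  show "grading ((F1 ^^ n) u) = (\<mu> - of_nat n) *s (F1 ^^ n) u"
  proof (induction n)
    case (Suc n)
    show ?case
      unfolding funpow.simps o_apply grading_F Suc.IH step[OF F1.linear_axioms]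
      by (simp add: algebra_simps)
  qed (simp add: assms)
  show "grading ((F2 ^^ n) u) = (\<mu> - of_nat n) *s (F2 ^^ n) u"
  proof (induction n)
    case (Suc n)
    show ?case
      unfolding funpow.simps o_apply grading_F Suc.IH step[OF F2.linear_axioms]
      by (simp add: algebra_simps)
  qed (simp add: assms)
qed

end

section \<open>Independence of the admissible monomials\<close>

locale hw_module = chevalley_module scale E1 E2 F1 F2 H1 H2
  for scale :: "complex \<Rightarrow> 'v::ab_group_add \<Rightarrow> 'v" (infixr "*s" 75) and E1 E2 F1 F2 H1 H2 +
  fixes v :: 'v and m1 m2 :: nat
  assumes v_nonzero: "v \<noteq> 0" and E1_v: "E1 v = 0" and E2_v: "E2 v = 0"
    and H1_v: "H1 v = of_nat m1 *s v" and H2_v: "H2 v = of_nat m2 *s v"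
begin

abbreviation model_hw :: "idx list \<Rightarrow> complex" where
  "model_hw \<equiv> word_delta (start_word m1 m2)"

text \<open>The submodule generated by the pair of highest weight vectors in the direct sum of the module
  and the word model; as its part of degree 0 is a line, a relation between the first
  components of the vectors of one degree transfers to the second components.\<close>

inductive paired :: "nat \<Rightarrow> 'v \<Rightarrow> (idx list \<Rightarrow> complex) \<Rightarrow> bool" where
  base: "paired 0 v model_hw"
| F1: "paired k x y \<Longrightarrow> paired (Suc k) (F1 x) (act mat_f1 y)"
| F2: "paired k x y \<Longrightarrow> paired (Suc k) (F2 x) (act mat_f2 y)"
| lincomb: "paired k x y \<Longrightarrow> paired k x' y' \<Longrightarrow> paired k (c *s x + x') (\<lambda>w. c * y w + y' w)"

lemma paired_zero: "paired k x y \<Longrightarrow> paired k 0 (\<lambda>w. 0)"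
  using paired.lincomb[of k x y x y "-1"] by simp

lemma paired_scale: "paired k x y \<Longrightarrow> paired k (c *s x) (\<lambda>w. c * y w)"
  using paired.lincomb[OF _ paired_zero] by fastforce

lemma paired_0: "paired k x y \<Longrightarrow> k = 0 \<Longrightarrow> \<exists>c. x = c *s v \<and> y = (\<lambda>w. c * model_hw w)"
proof (induction rule: paired.induct)
  case base
  show ?case by (rule exI[of _ 1]) simp
next
  case (lincomb k x y x' y' c)
  then obtain a b where "x = a *s v" "y = (\<lambda>w. a * model_hw w)" "x' = b *s v" "y' = (\<lambda>w. b * model_hw w)"
    by blast
  then show ?case
    by (intro exI[of _ "c * a + b"]) (simp add: algebra_simps)
qed simp_all

lemma paired_H:
  "paired k x y \<Longrightarrow> paired k (H1 x) (act mat_h1 y)"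
  "paired k x y \<Longrightarrow> paired k (H2 x) (act mat_h2 y)"
proof -
  assume "paired k x y"
  then have "paired k (H1 x) (act mat_h1 y) \<and> paired k (H2 x) (act mat_h2 y)"
  proof (induction rule: paired.induct)
    case base
    show ?case unfolding H1_v H2_v start_word_hw by (intro conjI paired_scale paired.base)
  next
    case (F1 k x y)
    have F1x: "paired (Suc k) (F1 x) (act mat_f1 y)" by (rule paired.F1[OF F1.hyps])
    have "paired (Suc k) (F1 (H1 x)) (act mat_f1 (act mat_h1 y))"
      "paired (Suc k) (F1 (H2 x)) (act mat_f1 (act mat_h2 y))"
      using F1.IH paired.F1 by blast+
    from paired.lincomb[OF F1x this(1), of "-2"] paired.lincomb[OF F1x this(2), of 1]
    show ?case unfolding act_mat_relations H1_F1 H2_F1 by (simp add: algebra_simps)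
  next
    case (F2 k x y)
    have F2x: "paired (Suc k) (F2 x) (act mat_f2 y)" by (rule paired.F2[OF F2.hyps])
    have "paired (Suc k) (F2 (H1 x)) (act mat_f2 (act mat_h1 y))"
      "paired (Suc k) (F2 (H2 x)) (act mat_f2 (act mat_h2 y))"
      using F2.IH paired.F2 by blast+
    from paired.lincomb[OF F2x this(1), of 2] paired.lincomb[OF F2x this(2), of "-2"]
    show ?case unfolding act_mat_relations H1_F2 H2_F2 by (simp add: algebra_simps)
  next
    case (lincomb k x y x' y' c)
    then show ?case by (simp add: H1.add H1.scale H2.add H2.scale act_lincomb paired.lincomb)
  qed
  then show "paired k (H1 x) (act mat_h1 y)" "paired k (H2 x) (act mat_h2 y)" by blast+
qed

text \<open>The part of degree \<open>k - 1\<close>, where degree -1 is zero; truncated subtraction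
  would confuse it with degree 0.\<close>

definition lowered :: "nat \<Rightarrow> 'v \<Rightarrow> (idx list \<Rightarrow> complex) \<Rightarrow> bool" where
  "lowered k x y \<longleftrightarrow> (case k of 0 \<Rightarrow> x = 0 \<and> y = (\<lambda>w. 0) | Suc k \<Rightarrow> paired k x y)"

lemma lowered_add: "lowered k x y \<Longrightarrow> lowered k x' y' \<Longrightarrow> lowered k (c *s x + x') (\<lambda>w. c * y w + y' w)"
  by (auto simp: lowered_def paired.lincomb split: nat.splits)

lemma lowered_F:
  "lowered k x y \<Longrightarrow> paired k x' y' \<Longrightarrow> paired k (F1 x + x') (\<lambda>w. act mat_f1 y w + y' w)"
  "lowered k x y \<Longrightarrow> paired k x' y' \<Longrightarrow> paired k (F2 x + x') (\<lambda>w. act mat_f2 y w + y' w)"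
proof -
  assume "lowered k x y" "paired k x' y'"
  then show "paired k (F1 x + x') (\<lambda>w. act mat_f1 y w + y' w)" "paired k (F2 x + x') (\<lambda>w. act mat_f2 y w + y' w)"
    using paired.lincomb[OF paired.F1, of _ x y x' y' 1] paired.lincomb[OF paired.F2, of _ x y x' y' 1]
    by (auto simp: lowered_def act_zero split: nat.splits)
qed

text \<open>The submodule is built from lowering operators alone. It is stable under the raising
  operators because moving \<open>E1\<close> or \<open>E2\<close> past \<open>F1\<close> or
  \<open>F2\<close> leaves at most a Cartan term of the same degree.\<close>

lemma paired_E_lowered:
  "paired k x y \<Longrightarrow> lowered k (E1 x) (act mat_e1 y) \<and> lowered k (E2 x) (act mat_e2 y)"
proof (induction rule: paired.induct)
  case base
  show ?case by (simp add: lowered_def E1_v E2_v start_word_hw)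
next
  case (F1 k x y)
  have "paired k (F1 (E1 x) + H1 x) (\<lambda>w. act mat_f1 (act mat_e1 y) w + act mat_h1 y w)"
    "paired k (F1 (E2 x)) (act mat_f1 (act mat_e2 y))"
    using lowered_F(1) F1.IH paired_H[OF F1.hyps] paired_zero[OF F1.hyps] by fastforce+
  then show ?case by (simp add: lowered_def E1_F1 E2_F1 act_mat_relations)
next
  case (F2 k x y)
  have "paired k (F2 (E2 x) + H2 x) (\<lambda>w. act mat_f2 (act mat_e2 y) w + act mat_h2 y w)"
    "paired k (F2 (E1 x)) (act mat_f2 (act mat_e1 y))"
    using lowered_F(2) F2.IH paired_H[OF F2.hyps] paired_zero[OF F2.hyps] by fastforce+
  then show ?case by (simp add: lowered_def E2_F2 E1_F2 act_mat_relations)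
next
  case (lincomb k x y x' y' c)
  then show ?case by (simp add: E1.add E1.scale E2.add E2.scale act_lincomb lowered_add)
qed

lemma paired_E:
  "paired (Suc k) x y \<Longrightarrow> paired k (E1 x) (act mat_e1 y)"
  "paired (Suc k) x y \<Longrightarrow> paired k (E2 x) (act mat_e2 y)"
  using paired_E_lowered[of "Suc k" x y] by (simp_all add: lowered_def)

lemma paired_F_pow:
  "paired k x y \<Longrightarrow> paired (n + k) ((F1 ^^ n) x) ((act mat_f1 ^^ n) y)"
  "paired k x y \<Longrightarrow> paired (n + k) ((F2 ^^ n) x) ((act mat_f2 ^^ n) y)"
  by (induction n) (simp_all add: paired.F1 paired.F2)

lemma paired_E_pow:
  "paired (n + k) x y \<Longrightarrow> paired k ((E1 ^^ n) x) ((act mat_e1 ^^ n) y)"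
  "paired (n + k) x y \<Longrightarrow> paired k ((E2 ^^ n) x) ((act mat_e2 ^^ n) y)"
  by (induction n arbitrary: x y) (simp_all add: paired_E funpow_swap1)

text \<open>The nesting and the final \<open>+ 0\<close> are the shape of the degree that iterating
  \<open>paired_F_pow\<close> from \<open>paired.base\<close> produces.\<close>

fun weight_length :: "nat \<times> nat \<times> nat \<times> nat \<Rightarrow> nat" where
  "weight_length (a1, a2, a3, a4) = a4 + (a3 + (a2 + (a1 + 0)))"

lemma paired_monomial:
  "paired (weight_length a) (monomial_op F1 F2 a v) (word_op a model_hw)"
  by (cases a) (simp only: monomial_op.simps weight_length.simps paired_F_pow paired.base)

text \<open>By adjointness the word in the lowering operators becomes a word in the raising
  operators applied to \<open>y\<close>. This lands in degree 0, where the first component 0 forces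
  the second to vanish because \<open>v\<close> is nonzero.\<close>

lemma pairing_monomial_zero:
  assumes "paired (weight_length a) 0 y"
  shows "pairing n (word_op a model_hw) y = 0"
proof -
  obtain a1 a2 a3 a4 where a: "a = (a1, a2, a3, a4)" by (cases a)
  define z where "z = (act mat_e2 ^^ a1) ((act mat_e1 ^^ a2) ((act mat_e2 ^^ a3) ((act mat_e1 ^^ a4) y)))"
  have pow0: "(E1 ^^ n) 0 = 0" "(E2 ^^ n) 0 = 0" for n by (induction n) simp_all
  have "paired 0 0 z"
    using paired_E_pow(2)[OF paired_E_pow(1)[OF paired_E_pow(2)[OF paired_E_pow(1)[OF assms[unfolded a weight_length.simps]]]]]
    by (simp add: z_def pow0)
  then obtain c where "0 = c *s v" "z = (\<lambda>w. c * model_hw w)" using paired_0 by blast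
  then have "z = (\<lambda>w. 0)" using v_nonzero by simp
  moreover have "pairing n (word_op a model_hw) y = pairing n model_hw z"
    unfolding a monomial_op.simps pairing_act_pow z_def mat_e1_def[abs_def] mat_e2_def[abs_def] ..
  ultimately show ?thesis by simp
qed

lemma mat_f_Reals: "mat_f1 i j \<in> \<real>" "mat_f2 i j \<in> \<real>"
  by (cases i; cases j; simp)+

lemma word_op_Reals: "word_op a model_hw w \<in> \<real>"
proof -
  have "(\<And>w. \<psi> w \<in> \<real>) \<Longrightarrow> (act mat_f1 ^^ n) \<psi> w \<in> \<real>" "(\<And>w. \<psi> w \<in> \<real>) \<Longrightarrow> (act mat_f2 ^^ n) \<psi> w \<in> \<real>"
    for \<psi> n w by (induction n arbitrary: w) (simp_all add: act_Reals mat_f_Reals)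
  then show ?thesis by (cases a) (simp add: word_delta_def)
qed

abbreviation top_degree :: complex where
  "top_degree \<equiv> 3/2 * of_nat m1 + 2 * of_nat m2"

lemma grading_v: "grading v = top_degree *s v"
  by (simp add: grading_def H1_v H2_v scale_left_distrib)

lemma grading_monomial:
  "grading (monomial_op F1 F2 a v) = (top_degree - of_nat (weight_length a)) *s monomial_op F1 F2 a v"
proof -
  obtain a1 a2 a3 a4 where a: "a = (a1, a2, a3, a4)" by (cases a)
  from grading_F_pow(1)[OF grading_F_pow(2)[OF grading_F_pow(1)[OF grading_F_pow(2)[OF grading_v]]], of a4 a3 a2 a1]
  show ?thesis by (simp add: a algebra_simps)
qed

text \<open>The relation in the module pairs 0 with the vector \<open>y\<close> of the word model.
  This \<open>y\<close> is orthogonal to all monomials of its degree, hence to its own conjugate,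
  and so vanishes; leading coefficients then finish the argument.\<close>

lemma monomials_independent_homogeneous:
  assumes "finite S" "S \<subseteq> admissible m1 m2" "\<And>a. a \<in> S \<Longrightarrow> weight_length a = k"
    and sum: "(\<Sum>a\<in>S. c a *s monomial_op F1 F2 a v) = 0" and "a \<in> S"
  shows "c a = 0"
proof -
  define y where "y = (\<lambda>w. \<Sum>a\<in>S. c a * word_op a model_hw w)"
  \<comment> \<open>The empty sum is split off because the induction has no pair of degree
    \<open>k\<close> to start from.\<close>
  have "S = {} \<or> paired k (\<Sum>a\<in>S. c a *s monomial_op F1 F2 a v) (\<lambda>w. \<Sum>a\<in>S. c a * word_op a model_hw w)"
    using assms(1,3)
  proof (induction S rule: finite_induct)
    case (insert b S)
    have b: "paired k (monomial_op F1 F2 b v) (word_op b model_hw)"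
      using paired_monomial[of b] insert.prems by simp
    show ?case
    proof (cases "S = {}")
      case True
      then show ?thesis using paired_scale[OF b] by simp
    next
      case False
      then show ?thesis using insert paired.lincomb[OF b] by simp
    qed
  qed simp
  then have y: "paired k 0 y" using sum \<open>a \<in> S\<close> by (auto simp: y_def)
  have "pairing n (\<lambda>w. cnj (y w)) y = 0" for n
  proof -
    \<comment> \<open>The word vectors have real coordinates, so the conjugate of \<open>y\<close>
      is again a combination of them.\<close>
    have "(\<lambda>w. cnj (y w)) = (\<lambda>w. \<Sum>a\<in>S. cnj (c a) * word_op a model_hw w)"
      using word_op_Reals by (simp add: y_def Reals_cnj_iff)
    then show ?thesis
      using pairing_monomial_zero y assms(3) by (simp add: pairing_sum)
  qed
  then have y0: "y w = 0" for w using pairing_cnj_eq_0 by blast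
  show ?thesis
  proof (rule ccontr)
    assume "c a \<noteq> 0"
    \<comment> \<open>Among the exponents with nonzero coefficient, \<open>b\<close> has the least
      \<open>height12\<close>. At a word with leading exponent \<open>b\<close> every other monomial
      that is nonzero would have smaller height, so only \<open>b\<close> contributes.\<close>
    define T where "T = {a \<in> S. c a \<noteq> 0}"
    have "a \<in> T" "finite T" using \<open>c a \<noteq> 0\<close> \<open>a \<in> S\<close> assms(1) by (simp_all add: T_def)
    then have "T \<noteq> {}" by blast
    then obtain b where b: "b \<in> T" "\<And>a. a \<in> T \<Longrightarrow> height12 b \<le> height12 a"
      using arg_min_if_finite[OF \<open>finite T\<close>, of height12] not_le by blast
    obtain w where w: "map source w = start_word m1 m2" "lead_word w = b"
      using admissible_lead_word b(1) assms(2) by (metis (no_types, lifting) T_def mem_Collect_eq subsetD)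
    have "c a * word_op a model_hw w = 0" if "a \<in> S" "a \<noteq> b" for a
      using word_coefficient_nonzero[of a w] b(2)[of a] that w by (force simp: T_def)
    then have "y w = c b * word_op b model_hw w"
      unfolding y_def using assms(1) b(1)
      by (subst sum.remove[of _ b]) (simp_all add: T_def sum.neutral del: monomial_op.simps)
    moreover have "word_op b model_hw w \<noteq> 0" using word_coefficient_lead[of w] w by simp
    ultimately show False using y0 b(1) by (simp add: T_def)
  qed
qed

text \<open>The eigenvalues of \<open>grading\<close> separate the values of
  \<open>weight_length\<close>, which reduces the claim to the homogeneous case.\<close>

theorem monomials_independent:
  assumes "finite S" "S \<subseteq> admissible m1 m2"
    and sum: "(\<Sum>a\<in>S. c a *s monomial_op F1 F2 a v) = 0" and "a \<in> S"
  shows "c a = 0"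
proof -
  define x where "x = (\<lambda>k. \<Sum>a\<in>{a \<in> S. weight_length a = k}. c a *s monomial_op F1 F2 a v)"
  interpret D: Vector_Spaces.linear scale scale grading by (rule linear_grading)
  let ?K = "weight_length ` S"
  have "x (weight_length a) = 0"
  proof (rule eigenvectors_sum_zero[OF linear_grading, where K = ?K])
    show "inj_on (\<lambda>k. top_degree - of_nat k) ?K" by (auto simp: inj_on_def)
    show "grading (x k) = (top_degree - of_nat k) *s x k" for k
      unfolding x_def D.sum D.scale scale_sum_right grading_monomial
      by (rule sum.cong) (auto simp: mult.commute)
    show "sum x ?K = 0"
      unfolding x_def using sum.image_gen[OF assms(1), of "\<lambda>a. c a *s monomial_op F1 F2 a v" weight_length] sum by simp
  qed (use assms in auto)
  then have "(\<Sum>b\<in>{b \<in> S. weight_length b = weight_length a}. c b *s monomial_op F1 F2 b v) = 0"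
    by (simp only: x_def)
  then show ?thesis
    by (rule monomials_independent_homogeneous[rotated 3]) (use assms in auto)
qed

lemma monomial_nonzero: "a \<in> admissible m1 m2 \<Longrightarrow> monomial_op F1 F2 a v \<noteq> 0"
  using monomials_independent[of "{a}" "\<lambda>_. 1" a] by auto

end

section \<open>Spanning\<close>

locale hw_irrep = hw_module scale E1 E2 F1 F2 H1 H2 v m1 m2
  for scale :: "complex \<Rightarrow> 'v::ab_group_add \<Rightarrow> 'v" (infixr "*s" 75) and E1 E2 F1 F2 H1 H2 v m1 m2 +
  assumes finite_dimensional: "\<exists>B. finite B \<and> span B = UNIV"
    and irreducible: "subspace W \<Longrightarrow> (\<And>u. u \<in> W \<Longrightarrow> E1 u \<in> W \<and> E2 u \<in> W \<and> F1 u \<in> W \<and> F2 u \<in> W) \<Longrightarrow>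
      W = {0} \<or> W = UNIV"
begin

text \<open>Forgetting the word component of \<open>paired\<close> lets the levels inherit its
  closure properties.\<close>

definition level :: "nat \<Rightarrow> 'v set" where
  "level k = {x. \<exists>y. paired k x y}"

lemma level_0: "u \<in> level 0 \<Longrightarrow> \<exists>c. u = c *s v"
proof -
  assume "u \<in> level 0"
  then obtain y where "paired 0 u y" by (auto simp: level_def)
  from paired_0[OF this refl] show ?thesis by blast
qed

lemma level_nonempty: "\<exists>u. u \<in> level k"
proof (induction k)
  case 0
  show ?case using paired.base by (auto simp: level_def)
next
  case (Suc k)
  then obtain u y where "paired k u y" by (auto simp: level_def)
  from paired.F1[OF this] show ?case by (auto simp: level_def)
qed

lemma level_lincomb: "u \<in> level k \<Longrightarrow> u' \<in> level k \<Longrightarrow> c *s u + u' \<in> level k"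
  using paired.lincomb by (fastforce simp: level_def)

lemma level_zero [simp]: "0 \<in> level k"
  using level_nonempty paired_zero by (fastforce simp: level_def)

lemma level_F: "u \<in> level k \<Longrightarrow> F1 u \<in> level (Suc k)" "u \<in> level k \<Longrightarrow> F2 u \<in> level (Suc k)"
  unfolding level_def mem_Collect_eq by (metis paired.F1, metis paired.F2)

lemma level_E:
  "u \<in> level k \<Longrightarrow> E1 u \<in> level (k - 1)" "u \<in> level k \<Longrightarrow> E2 u \<in> level (k - 1)"
proof -
  assume "u \<in> level k"
  then obtain y where "paired k u y" by (auto simp: level_def)
  from paired_E_lowered[OF this] show "E1 u \<in> level (k - 1)" "E2 u \<in> level (k - 1)"
    by (auto simp: level_def lowered_def level_zero[unfolded level_def, simplified] split: nat.splits)
qed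

lemma grading_level: "u \<in> level k \<Longrightarrow> grading u = (top_degree - of_nat k) *s u"
proof -
  interpret D: Vector_Spaces.linear scale scale grading by (rule linear_grading)
  have "paired k u y \<Longrightarrow> grading u = (top_degree - of_nat k) *s u" for y
  proof (induction rule: paired.induct)
    case base
    show ?case using grading_v by simp
  next
    case (F1 k x y)
    then show ?case using grading_F_pow(1)[OF F1.IH, of 1] by (simp add: algebra_simps)
  next
    case (F2 k x y)
    then show ?case using grading_F_pow(2)[OF F2.IH, of 1] by (simp add: algebra_simps)
  next
    case (lincomb k x y x' y' c)
    then show ?case by (simp add: D.add D.scale scale_right_distrib mult.commute del: of_nat_Suc)
  qed
  then show "u \<in> level k \<Longrightarrow> grading u = (top_degree - of_nat k) *s u" by (auto simp: level_def)
qed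

lemma span_levels: "span (\<Union>k. level k) = UNIV"
proof -
  let ?L = "\<Union>k. level k"
  have into: "f u \<in> span ?L"
    if "Vector_Spaces.linear scale scale f" "\<And>u k. u \<in> level k \<Longrightarrow> f u \<in> level (g k)" "u \<in> span ?L" for f g u
  proof (rule span_linear_into[OF that(1) _ that(3)])
    fix u assume "u \<in> ?L"
    then obtain k where "u \<in> level k" by blast
    then show "f u \<in> span ?L" by (intro span_base) (use that(2) in blast)
  qed
  have "span ?L = {0} \<or> span ?L = UNIV"
  proof (rule irreducible[OF subspace_span])
    fix u assume u: "u \<in> span ?L"
    show "E1 u \<in> span ?L \<and> E2 u \<in> span ?L \<and> F1 u \<in> span ?L \<and> F2 u \<in> span ?L"
      by (intro conjI into[OF E1.linear_axioms level_E(1) u] into[OF E2.linear_axioms level_E(2) u]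
        into[OF F1.linear_axioms level_F(1) u] into[OF F2.linear_axioms level_F(2) u])
  qed
  moreover have "v \<in> span ?L"
    using paired.base by (intro span_base) (auto simp: level_def)
  ultimately show ?thesis using v_nonzero by auto
qed

lemma level_decomposition:
  "\<exists>x N. (\<forall>k. x k \<in> level k) \<and> (\<forall>k>N. x k = 0) \<and> u = (\<Sum>k\<le>N. x k)"
proof -
  have "u \<in> span (\<Union>k. level k)" by (simp add: span_levels)
  then show ?thesis
  proof (induction rule: span_induct_alt)
    case base
    show ?case by (intro exI[of _ "\<lambda>_. 0"] exI[of _ 0]) simp
  next
    case (step c b u)
    from step(1) obtain j where j: "b \<in> level j" by blast
    from step(2) obtain x N where x: "\<And>k. x k \<in> level k" "\<And>k. k > N \<Longrightarrow> x k = 0" "u = (\<Sum>k\<le>N. x k)" by blast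
    let ?x = "\<lambda>k. (if k = j then c *s b else 0) + x k" and ?N = "max N j"
    have "(\<Sum>k\<le>?N. x k) = (\<Sum>k\<le>N. x k)"
      by (rule sum.mono_neutral_right) (auto simp: x(2))
    then have "c *s b + u = (\<Sum>k\<le>?N. ?x k)"
      unfolding sum.distrib x(3) by (simp add: sum.delta)
    moreover have "?x k \<in> level k" for k
      using level_lincomb[OF j x(1)[of j], of c] x(1) by simp
    ultimately show ?case using x(2) by (intro exI[of _ ?x] exI[of _ ?N]) auto
  qed
qed

text \<open>Levels span, so \<open>grading\<close> has no eigenvalues other than those of the
  levels, and an eigenvector is its own component in the level of its eigenvalue.\<close>

lemma grading_eigenvector:
  assumes "grading u = \<mu> *s u" and "u \<noteq> 0"
  obtains k where "\<mu> = top_degree - of_nat k" and "u \<in> level k"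
proof -
  interpret D: Vector_Spaces.linear scale scale grading by (rule linear_grading)
  obtain x N where x: "\<And>k. x k \<in> level k" "\<And>k. k > N \<Longrightarrow> x k = 0" "u = (\<Sum>k\<le>N. x k)"
    using level_decomposition by metis
  show ?thesis
  proof (cases "\<exists>k\<le>N. \<mu> = top_degree - of_nat k")
    case False
    \<comment> \<open>With a new eigenvalue, \<open>- u\<close> joins the components of
      \<open>u\<close> as an extra one at index \<open>Suc N\<close>; the sum is then 0, so
      \<open>u\<close> vanishes.\<close>
    define \<nu> where "\<nu> = (\<lambda>k. if k = Suc N then \<mu> else top_degree - of_nat k)"
    define z where "z = (\<lambda>k. if k = Suc N then - u else x k)"
    have "z (Suc N) = 0"
    proof (rule eigenvectors_sum_zero[OF linear_grading, where K = "{..Suc N}" and \<mu> = \<nu>])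
      show "inj_on \<nu> {..Suc N}" using False by (auto simp: inj_on_def \<nu>_def le_Suc_eq)
      show "grading (z k) = \<nu> k *s z k" for k
        using assms(1) grading_level[OF x(1)] by (simp add: z_def \<nu>_def D.neg)
      show "sum z {..Suc N} = 0" by (simp add: z_def x(3))
    qed auto
    then show ?thesis using assms(2) by (simp add: z_def)
  next
    case True
    then obtain j where j: "j \<le> N" "\<mu> = top_degree - of_nat j" by blast
    \<comment> \<open>Subtracting \<open>u\<close> from its component in level \<open>j\<close>
      again makes the sum 0.\<close>
    define z where "z = (\<lambda>k. x k - (if k = j then u else 0))"
    have "z j = 0"
    proof (rule eigenvectors_sum_zero[OF linear_grading, where K = "{..N}"])
      show "inj_on (\<lambda>k. top_degree - of_nat k) {..N}" by (auto simp: inj_on_def)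
      show "grading (z k) = (top_degree - of_nat k) *s z k" for k
        using assms(1) j grading_level[OF x(1)] by (simp add: z_def D.diff scale_right_diff_distrib)
      show "sum z {..N} = 0" using j by (simp add: z_def sum_subtractf x(3)[symmetric])
    qed (use j in auto)
    then show ?thesis using that j(2) x(1)[of j] by (simp add: z_def)
  qed
qed

lemma finite_degrees: "finite {k. \<exists>u\<in>level k. u \<noteq> 0}"
proof -
  obtain B where "finite B" "span B = UNIV" using finite_dimensional by blast
  then have "finite {\<mu>. \<exists>u. u \<noteq> 0 \<and> grading u = \<mu> *s u}"
    by (rule finite_eigenvalues[OF linear_grading])
  then have "finite ((\<lambda>k. top_degree - of_nat k) -` {\<mu>. \<exists>u. u \<noteq> 0 \<and> grading u = \<mu> *s u})"
    by (rule finite_vimageI) (auto simp: inj_def)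
  then show ?thesis
    by (rule rev_finite_subset) (use grading_level in blast)
qed

text \<open>Each application raises the degree, and only finitely many levels are nonzero.\<close>

lemma F_nilpotent:
  assumes "u \<in> level k"
  shows "\<exists>n. (F1 ^^ n) u = 0" "\<exists>n. (F2 ^^ n) u = 0"
proof -
  have lev: "(F1 ^^ n) u \<in> level (n + k)" "(F2 ^^ n) u \<in> level (n + k)" for n
    by (induction n) (simp_all add: assms level_F)
  obtain N where N: "\<And>k u. u \<in> level k \<Longrightarrow> u \<noteq> 0 \<Longrightarrow> k < N"
    using finite_degrees unfolding finite_nat_set_iff_bounded by blast
  show "\<exists>n. (F1 ^^ n) u = 0" "\<exists>n. (F2 ^^ n) u = 0"
    using N[OF lev(1)[of N]] N[OF lev(2)[of N]] by (auto intro!: exI[of _ N])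
qed

lemma E_nilpotent:
  assumes "u \<in> level k"
  shows "(E1 ^^ Suc k) u = 0" "(E2 ^^ Suc k) u = 0"
proof -
  have *: "u \<in> level k \<Longrightarrow> (E1 ^^ Suc k) u = 0 \<and> (E2 ^^ Suc k) u = 0" for u
  proof (induction k arbitrary: u)
    case 0
    then show ?case using level_0[OF 0] E1_v E2_v E1.scale E2.scale by auto
  next
    case (Suc k)
    show ?case
      using Suc.IH[OF level_E(1)[OF Suc.prems, simplified]] Suc.IH[OF level_E(2)[OF Suc.prems, simplified]]
      by (simp add: funpow_swap1)
  qed
  show "(E1 ^^ Suc k) u = 0" "(E2 ^^ Suc k) u = 0" using *[OF assms] by blast+
qed

section \<open>Lowest weight vector and the span of all monomials\<close>

fun F_word :: "bool list \<Rightarrow> 'v" where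
  "F_word [] = v"
| "F_word (b # bs) = (if b then F1 else F2) (F_word bs)"

lemma F_word_level: "F_word bs \<in> level (length bs)"
proof (induction bs)
  case Nil
  show ?case using paired.base by (auto simp: level_def)
qed (simp add: level_F)

lemma F_word_weight: "\<exists>c1 c2. H1 (F_word bs) = c1 *s F_word bs \<and> H2 (F_word bs) = c2 *s F_word bs"
proof (induction bs)
  case Nil
  show ?case using H1_v H2_v by auto
next
  case (Cons b bs)
  then obtain c1 c2 where c: "H1 (F_word bs) = c1 *s F_word bs" "H2 (F_word bs) = c2 *s F_word bs" by blast
  show ?case
  proof (cases b)
    case True
    then show ?thesis
      by (intro exI[of _ "c1 - 2"] exI[of _ "c2 + 1"])
        (simp add: H1_F1 H2_F1 c F1.scale scale_left_diff_distrib scale_left_distrib)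
  next
    case False
    then show ?thesis
      by (intro exI[of _ "c1 + 2"] exI[of _ "c2 - 2"])
        (simp add: H1_F2 H2_F2 c F2.scale scale_left_diff_distrib scale_left_distrib)
  qed
qed

text \<open>A longest nonzero word in \<open>F1\<close> and \<open>F2\<close> applied to
  \<open>v\<close> is killed by both and is a weight vector. The sl2 theory with \<open>E\<close>
  and \<open>F\<close> exchanged makes its weight integral, so it is a highest weight vector for the
  exchanged generators.\<close>

lemma lowest_weight_vector:
  obtains w n1 n2 k where
    "hw_irrep scale F1 F2 E1 E2 (\<lambda>u. - H1 u) (\<lambda>u. - H2 u) w n1 n2" "w \<in> level k"
proof -
  define L where "L = {length bs | bs. F_word bs \<noteq> 0}"
  have "L \<subseteq> {k. \<exists>u\<in>level k. u \<noteq> 0}" using F_word_level by (fastforce simp: L_def)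
  then have fin: "finite L" using finite_degrees finite_subset by blast
  have "F_word [] \<noteq> 0" using v_nonzero by simp
  then have "length ([] :: bool list) \<in> L" unfolding L_def by blast
  then have "Max L \<in> L" using fin Max_in by blast
  then obtain bs where bs: "length bs = Max L" "F_word bs \<noteq> 0" by (auto simp: L_def)
  define w where "w = F_word bs"
  have "F_word (b # bs) = 0" for b
  proof (rule ccontr)
    assume "F_word (b # bs) \<noteq> 0"
    then have "length (b # bs) \<in> L" unfolding L_def by blast
    then show False using Max_ge[OF fin, of "length (b # bs)"] bs(1) by simp
  qed
  from this[of True] this[of False] have Fw: "F1 w = 0" "F2 w = 0" by (simp_all add: w_def)
  obtain c1 c2 where c: "H1 w = c1 *s w" "H2 w = c2 *s w" using F_word_weight w_def by blast
  have wl: "w \<in> level (Max L)" using F_word_level[of bs] bs(1) w_def by simp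
  interpret dual: chevalley_module scale F1 F2 E1 E2 "\<lambda>u. - H1 u" "\<lambda>u. - H2 u"
    by (rule chevalley_involution)
  obtain n1 where n1: "- c1 = of_nat n1"
  proof (rule sl2_integral_highest_weight[OF F1.linear_axioms E1.linear_axioms dual.H1.linear_axioms dual.E1_F1 dual.H1_F1])
    show "- H1 w = (- c1) *s w" using c by simp
    show "\<exists>k. (E1 ^^ k) w = 0" using E_nilpotent[OF wl] by blast
  qed (use Fw bs w_def in auto)
  obtain n2 where n2: "- c2 = of_nat n2"
  proof (rule sl2_integral_highest_weight[OF F2.linear_axioms E2.linear_axioms dual.H2.linear_axioms dual.E2_F2 dual.H2_F2])
    show "- H2 w = (- c2) *s w" using c by simp
    show "\<exists>k. (E2 ^^ k) w = 0" using E_nilpotent[OF wl] by blast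
  qed (use Fw bs w_def in auto)
  have "hw_irrep scale F1 F2 E1 E2 (\<lambda>u. - H1 u) (\<lambda>u. - H2 u) w n1 n2"
  proof
    show "w \<noteq> 0" "F1 w = 0" "F2 w = 0" using bs Fw w_def by simp_all
    show "- H1 w = of_nat n1 *s w" "- H2 w = of_nat n2 *s w" using c n1[symmetric] n2[symmetric] by simp_all
    show "\<exists>B. finite B \<and> span B = UNIV" by (rule finite_dimensional)
    show "W = {0} \<or> W = UNIV"
      if "subspace W" "\<And>u. u \<in> W \<Longrightarrow> F1 u \<in> W \<and> F2 u \<in> W \<and> E1 u \<in> W \<and> E2 u \<in> W" for W
      using irreducible that by blast
  qed
  then show ?thesis using that wl by blast
qed

text \<open>Each entry is the length of the string through the preceding extremal vector, along a
  reduced word of the longest Weyl group element.\<close>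

definition lowest_index :: "nat \<times> nat \<times> nat \<times> nat" where
  "lowest_index = (m2, m1 + 2 * m2, m1 + m2, m1)"

lemma lowest_index_admissible: "lowest_index \<in> admissible m1 m2"
  by (simp add: lowest_index_def admissible_def)

lemma grading_lowest: "grading (monomial_op F1 F2 lowest_index v) = (- top_degree) *s monomial_op F1 F2 lowest_index v"
proof -
  have "top_degree - of_nat (weight_length lowest_index) = - top_degree"
    by (simp add: lowest_index_def)
  then show ?thesis using grading_monomial[of lowest_index] by simp
qed

definition strings :: "('v \<Rightarrow> 'v) \<Rightarrow> 'v set \<Rightarrow> 'v set" where
  "strings f A = {(f ^^ k) u | k u. u \<in> A}"

lemma stringsI: "u \<in> A \<Longrightarrow> (f ^^ k) u \<in> strings f A"
  unfolding strings_def by blast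

lemma strings_subset: "A \<subseteq> strings f A"
proof
  fix u assume "u \<in> A"
  then have "(f ^^ 0) u \<in> strings f A" unfolding strings_def by blast
  then show "u \<in> strings f A" by simp
qed

lemma strings_closed: "u \<in> strings f A \<Longrightarrow> f u \<in> strings f A"
proof -
  assume "u \<in> strings f A"
  then obtain k x where "x \<in> A" "u = (f ^^ k) x" by (auto simp: strings_def)
  then have "f u = (f ^^ Suc k) x" "x \<in> A" by simp_all
  then show "f u \<in> strings f A" unfolding strings_def by blast
qed

definition borel_stable :: "'v set \<Rightarrow> bool" where
  "borel_stable A \<longleftrightarrow> (\<forall>u\<in>A. E1 u \<in> span A \<and> E2 u \<in> span A \<and> H1 u \<in> span A \<and> H2 u \<in> span A)"

text \<open>Along a string, \<open>E2\<close> commutes with \<open>F1\<close>, while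
  \<open>E1\<close> past \<open>F1\<close> produces \<open>H1\<close>, which preserves the span as
  well.\<close>

lemma borel_stable_strings_F1: "borel_stable A \<Longrightarrow> borel_stable (strings F1 A)"
proof -
  let ?S = "span (strings F1 A)"
  assume A: "borel_stable A"
  have F: "F1 u \<in> ?S" if "u \<in> ?S" for u
    using span_linear_into[OF F1.linear_axioms _ that] strings_closed span_base by blast
  have "H1 ((F1 ^^ k) u) \<in> ?S \<and> H2 ((F1 ^^ k) u) \<in> ?S \<and> E1 ((F1 ^^ k) u) \<in> ?S \<and> E2 ((F1 ^^ k) u) \<in> ?S"
    if "u \<in> A" for k u
  proof (induction k)
    case 0
    show ?case using A that span_mono[OF strings_subset] by (auto simp: borel_stable_def)
  next
    case (Suc k)
    have "F1 ((F1 ^^ k) u) \<in> ?S"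
      using that by (intro F span_base) (auto simp: strings_def)
    then show ?case using Suc
      by (simp add: H1_F1 H2_F1 E1_F1 E2_F1 F span_add span_diff span_scale)
  qed
  then show ?thesis unfolding borel_stable_def strings_def by blast
qed

lemma borel_stable_strings_F2: "borel_stable A \<Longrightarrow> borel_stable (strings F2 A)"
proof -
  let ?S = "span (strings F2 A)"
  assume A: "borel_stable A"
  have F: "F2 u \<in> ?S" if "u \<in> ?S" for u
    using span_linear_into[OF F2.linear_axioms _ that] strings_closed span_base by blast
  have "H1 ((F2 ^^ k) u) \<in> ?S \<and> H2 ((F2 ^^ k) u) \<in> ?S \<and> E1 ((F2 ^^ k) u) \<in> ?S \<and> E2 ((F2 ^^ k) u) \<in> ?S"
    if "u \<in> A" for k u
  proof (induction k)
    case 0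
    show ?case using A that span_mono[OF strings_subset] by (auto simp: borel_stable_def)
  next
    case (Suc k)
    have "F2 ((F2 ^^ k) u) \<in> ?S"
      using that by (intro F span_base) (auto simp: strings_def)
    then show ?case using Suc
      by (simp add: H1_F2 H2_F2 E1_F2 E2_F2 F span_add span_diff span_scale)
  qed
  then show ?thesis unfolding borel_stable_def strings_def by blast
qed

text \<open>The Demazure module of the longest Weyl group element: it is stable under the Borel
  subalgebra and contains a lowest weight vector, hence it is everything.\<close>

theorem span_all_monomials: "span (range (\<lambda>a. monomial_op F1 F2 a v)) = UNIV"
proof -
  define D where "D = strings F1 (strings F2 (strings F1 (strings F2 {v})))"
  have D: "D \<subseteq> range (\<lambda>a. monomial_op F1 F2 a v)"
  proof
    fix u assume "u \<in> D"
    then obtain a1 a2 a3 a4 where "u = monomial_op F1 F2 (a1, a2, a3, a4) v"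
      by (auto simp: D_def strings_def)
    then show "u \<in> range (\<lambda>a. monomial_op F1 F2 a v)" by blast
  qed
  have "borel_stable {v}"
    by (simp add: borel_stable_def E1_v E2_v H1_v H2_v span_zero span_scale span_base)
  then have stable: "borel_stable D"
    unfolding D_def by (intro borel_stable_strings_F1 borel_stable_strings_F2)
  obtain w n1 n2 k where dual: "hw_irrep scale F1 F2 E1 E2 (\<lambda>u. - H1 u) (\<lambda>u. - H2 u) w n1 n2"
    and wk: "w \<in> level k" by (rule lowest_weight_vector)
  interpret dual: hw_irrep scale F1 F2 E1 E2 "\<lambda>u. - H1 u" "\<lambda>u. - H2 u" w n1 n2 by (rule dual)
  have dual_grading: "dual.grading u = - grading u" for u
    by (simp add: dual.grading_def grading_def)
  let ?low = "monomial_op F1 F2 lowest_index v" and ?high = "monomial_op E1 E2 dual.lowest_index w"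
  have low: "?low \<noteq> 0" using monomial_nonzero lowest_index_admissible by blast
  have high: "?high \<noteq> 0" using dual.monomial_nonzero dual.lowest_index_admissible by blast
  \<comment> \<open>The two extremal monomials are nonzero, and their grading eigenvalues place each
    of the two top degrees at or below the other. Hence \<open>l = 0\<close> and \<open>?low\<close>
    is a multiple of \<open>w\<close>.\<close>
  obtain l where l: "top_degree = dual.top_degree - of_nat l" "?low \<in> dual.level l"
  proof (rule dual.grading_eigenvector[OF _ low])
    show "dual.grading ?low = top_degree *s ?low"
      unfolding dual_grading grading_lowest by (simp only: scale_minus_left minus_minus)
  qed
  obtain l' where l': "dual.top_degree = top_degree - of_nat l'"
  proof (rule grading_eigenvector[OF _ high])
    show "grading ?high = dual.top_degree *s ?high"
      using dual.grading_lowest unfolding dual_grading scale_minus_left by (simp only: neg_equal_iff_equal)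
  qed
  have "of_nat l + of_nat l' = (0 :: complex)"
  proof -
    have "x + y = 0" if "a = b - x" "b = a - y" for a b x y :: complex
    proof -
      have "x = b - a" by (simp add: that(1))
      moreover have "y = a - b" by (simp add: that(2))
      ultimately show ?thesis by simp
    qed
    from this[OF l(1) l'] show ?thesis .
  qed
  then have "of_nat (l + l') = (0 :: complex)" by simp
  then have "l = 0" by (simp only: of_nat_eq_0_iff add_is_0)
  then obtain c where c: "?low = c *s w" using dual.level_0 l(2) by blast
  have "?low \<in> D"
    by (simp add: lowest_index_def D_def stringsI)
  moreover have "w = (1 / c) *s ?low" using c low by auto
  ultimately have w: "w \<in> span D" by (metis span_base span_scale)
  \<comment> \<open>The dual levels arise from \<open>w\<close> by applying \<open>E1\<close> and
    \<open>E2\<close>, which preserve the span of \<open>D\<close>.\<close>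
  have "u \<in> span D" if "dual.paired k u y" for k u y
    using that
  proof (induction rule: dual.paired.induct)
    case base
    show ?case by (rule w)
  next
    case (F1 k x y)
    then show ?case using stable span_linear_into[OF E1.linear_axioms] by (auto simp: borel_stable_def)
  next
    case (F2 k x y)
    then show ?case using stable span_linear_into[OF E2.linear_axioms] by (auto simp: borel_stable_def)
  next
    case (lincomb k x y x' y' c)
    then show ?case by (simp add: span_add span_scale)
  qed
  then have "(\<Union>k. dual.level k) \<subseteq> span D" by (auto simp: dual.level_def)
  then have "span D = UNIV" using dual.span_levels span_mono span_span by (metis top.extremum_uniqueI)
  then show ?thesis using span_mono[OF D] by (metis top.extremum_uniqueI)
qed

end


section \<open>Reduction to the admissible exponents\<close>

lemma low_coefficients_cancel:
  assumes "\<And>k. k < c \<Longrightarrow> coeff ([:1, 1:] ^ n * q) k = (0 :: complex)" and "k < c"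
  shows "coeff q k = 0"
  using assms
proof (induction n arbitrary: k)
  case (Suc n)
  let ?q = "[:1, 1:] ^ n * q"
  have "coeff ([:1, 1:] ^ Suc n * q) k = coeff ?q k + (if k = 0 then 0 else coeff ?q (k - 1))" for k
    unfolding power_Suc mult.assoc by (cases k) simp_all
  then have "coeff ?q k = - (if k = 0 then 0 else coeff ?q (k - 1))" if "k < c" for k
    using Suc.prems(1)[OF that] by (simp add: eq_neg_iff_add_eq_0)
  then have "coeff ?q k = 0" if "k < c" for k
    using that by (induction k) simp_all
  then show ?case using Suc by blast
qed simp

text \<open>\<open>Y\<close> and \<open>Z\<close> are the root vectors for the negatives of
  \<alpha>1 + \<alpha>2 and 2 \<alpha>1 + \<alpha>2, where \<alpha>1 and \<alpha>2 are the simple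
  roots.\<close>

locale sp4_hw_irrep = hw_irrep scale E1 E2 F1 F2 H1 H2 v m1 m2 +
  Y: Vector_Spaces.linear scale scale Y + Z: Vector_Spaces.linear scale scale Z
  for scale :: "complex \<Rightarrow> 'v::ab_group_add \<Rightarrow> 'v" (infixr "*s" 75) and E1 E2 F1 F2 H1 H2 v m1 m2 Y Z +
  assumes F1_F2: "F1 (F2 u) = F2 (F1 u) + Y u" and F1_Y: "F1 (Y u) = Y (F1 u) + 2 *s Z u"
    and F1_Z: "F1 (Z u) = Z (F1 u)" and F2_Y: "F2 (Y u) = Y (F2 u)" and F2_Z: "F2 (Z u) = Z (F2 u)"
begin

text \<open>This is the expansion of a power of \<open>F1\<close> past \<open>F2\<close> by iterated
  brackets, which stops because \<open>F1\<close> commutes with \<open>Z\<close>. Where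
  \<open>b - 1\<close> or \<open>b - 2\<close> is truncated, its coefficient is 0.\<close>

lemma F1_pow_F2:
  "(F1 ^^ b) (F2 u) = F2 ((F1 ^^ b) u) + of_nat b *s Y ((F1 ^^ (b - 1)) u)
    + of_nat (b * (b - 1)) *s Z ((F1 ^^ (b - 2)) u)"
proof (induction b)
  case (Suc b)
  have Y: "of_nat b *s Y (F1 ((F1 ^^ (b - 1)) u)) = of_nat b *s Y ((F1 ^^ b) u)"
    by (cases b) simp_all
  have Z: "of_nat (b * (b - 1)) *s Z (F1 ((F1 ^^ (b - 2)) u)) = of_nat (b * (b - 1)) *s Z ((F1 ^^ (b - 1)) u)"
  proof (cases "b \<le> 1")
    case True
    then have "b * (b - 1) = 0" by (cases b) auto
    then show ?thesis by (simp only: of_nat_0 scale_zero_left)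
  next
    case False
    then have "b - 1 = Suc (b - 2)" by simp
    then show ?thesis by simp
  qed
  have "(F1 ^^ Suc b) (F2 u) = F2 (F1 ((F1 ^^ b) u)) + Y ((F1 ^^ b) u)
     + (of_nat b *s Y (F1 ((F1 ^^ (b - 1)) u)) + of_nat (2 * b) *s Z ((F1 ^^ (b - 1)) u))
     + of_nat (b * (b - 1)) *s Z (F1 ((F1 ^^ (b - 2)) u))"
    by (simp add: Suc F1.add F1.scale F1_F2 F1_Y F1_Z scale_right_distrib mult.commute)
  also have "\<dots> = F2 ((F1 ^^ Suc b) u) + of_nat (Suc b) *s Y ((F1 ^^ b) u)
     + of_nat (2 * b + b * (b - 1)) *s Z ((F1 ^^ (b - 1)) u)"
    unfolding Y Z by (simp add: scale_left_distrib)
  also have "2 * b + b * (b - 1) = Suc b * (Suc b - 1)" by (cases b) simp_all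
  finally show ?case by simp
qed simp

definition functional :: "('v \<Rightarrow> complex) \<Rightarrow> bool" where
  "functional \<psi> \<longleftrightarrow> (\<forall>u w. \<psi> (u + w) = \<psi> u + \<psi> w) \<and> (\<forall>c u. \<psi> (c *s u) = c * \<psi> u)"

lemma functional_zero: "functional \<psi> \<Longrightarrow> \<psi> 0 = 0"
  unfolding functional_def by (metis mult_zero_left scale_zero_left)

lemma functional_comp:
  assumes "functional \<psi>"
  shows "functional (\<lambda>u. \<psi> (F1 u))" "functional (\<lambda>u. \<psi> (F2 u))"
    "functional (\<lambda>u. \<psi> (Y u))" "functional (\<lambda>u. \<psi> (Z u))"
  using assms by (simp_all add: functional_def F1.add F1.scale F2.add F2.scale Y.add Y.scale Z.add Z.scale)

lemma functional_comp_pow: "functional \<psi> \<Longrightarrow> functional (\<lambda>u. \<psi> ((F1 ^^ n) u))"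
proof (induction n arbitrary: \<psi>)
  case (Suc n)
  show ?case using Suc.IH[OF functional_comp(1)[OF Suc.prems]] by simp
qed simp

text \<open>Since \<open>F2\<close> commutes with \<open>Y\<close> and \<open>Z\<close>, raising \<open>d\<close> by one multiplies this polynomial by
  \<open>1 + x\<close>, up to terms with smaller \<open>b\<close>. So up to powers of \<open>1 + x\<close> it has degree at most \<open>b\<close> and
  at most \<open>(b + m1) / 2\<close>, and it vanishes once that many low coefficients do.\<close>

definition insertion_poly :: "nat \<Rightarrow> nat \<Rightarrow> ('v \<Rightarrow> complex) \<Rightarrow> complex poly" where
  "insertion_poly d b \<psi> = (\<Sum>c\<le>d. monom (of_nat (d choose c) * \<psi> ((F2 ^^ c) ((F1 ^^ b) ((F2 ^^ (d - c)) v)))) c)"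

lemma coeff_insertion_poly:
  "coeff (insertion_poly d b \<psi>) c = of_nat (d choose c) * \<psi> ((F2 ^^ c) ((F1 ^^ b) ((F2 ^^ (d - c)) v)))"
  unfolding insertion_poly_def by (simp add: coeff_sum not_le binomial_eq_0)

lemma F2_pow_comm: "(F2 ^^ c) (Y u) = Y ((F2 ^^ c) u)" "(F2 ^^ c) (Z u) = Z ((F2 ^^ c) u)"
  by (induction c) (simp_all add: F2_Y F2_Z)

lemma F2_pow_linear: "(F2 ^^ c) (u + w) = (F2 ^^ c) u + (F2 ^^ c) w" "(F2 ^^ c) (r *s u) = r *s (F2 ^^ c) u"
  by (induction c) (simp_all add: F2.add F2.scale)

text \<open>By the Pascal rule each coefficient splits in two: in one part the innermost
  \<open>F2\<close> is moved left through the power of \<open>F1\<close>, in the other an outer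
  \<open>F2\<close> is peeled off. The two \<open>F2\<close> terms combine to the factor
  \<open>1 + x\<close>.\<close>

lemma insertion_poly_Suc:
  assumes "functional \<psi>"
  shows "insertion_poly (Suc d) b \<psi> = [:1, 1:] * insertion_poly d b (\<lambda>u. \<psi> (F2 u))
    + smult (of_nat b) (insertion_poly d (b - 1) (\<lambda>u. \<psi> (Y u)))
    + smult (of_nat (b * (b - 1))) (insertion_poly d (b - 2) (\<lambda>u. \<psi> (Z u)))"
proof (rule poly_eqI)
  fix c
  let ?g = "\<lambda>b c e. (F2 ^^ c) ((F1 ^^ b) ((F2 ^^ e) v))"
  have add: "\<psi> (u + w) = \<psi> u + \<psi> w" and scale: "\<psi> (r *s u) = r * \<psi> u" for u w r
    using assms by (auto simp: functional_def)
  have shift: "?g b c (Suc e) = F2 (?g b c e) + of_nat b *s Y (?g (b - 1) c e)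
      + of_nat (b * (b - 1)) *s Z (?g (b - 2) c e)" for e
    by (simp only: funpow.simps o_apply F1_pow_F2 F2_pow_linear F2_pow_comm funpow_swap1[symmetric, where f = F2 and n = c])
  have mult: "coeff ([:1, 1:] * p) c = coeff p c + (if c = 0 then 0 else coeff p (c - 1))" for p :: "complex poly"
    by (cases c) simp_all
  have "of_nat (Suc d choose c) * \<psi> (?g b c (Suc d - c)) =
      of_nat (d choose c) * \<psi> (?g b c (Suc (d - c)))
      + (if c = 0 then 0 else of_nat (d choose (c - 1)) * \<psi> (F2 (?g b (c - 1) (d - (c - 1)))))"
  proof (cases c)
    case (Suc c')
    show ?thesis
    proof (cases "c \<le> d")
      case True
      then have "Suc d - c = Suc (d - c)" "d - c' = Suc (d - c)" using Suc by linarith+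
      then show ?thesis using Suc by (simp add: distrib_right)
    qed (auto simp: Suc not_le less_Suc_eq binomial_eq_0)
  qed simp
  then show "coeff (insertion_poly (Suc d) b \<psi>) c = coeff ([:1, 1:] * insertion_poly d b (\<lambda>u. \<psi> (F2 u))
    + smult (of_nat b) (insertion_poly d (b - 1) (\<lambda>u. \<psi> (Y u)))
    + smult (of_nat (b * (b - 1))) (insertion_poly d (b - 2) (\<lambda>u. \<psi> (Z u)))) c"
    unfolding coeff_add mult coeff_smult coeff_insertion_poly shift add scale
    by (simp add: algebra_simps)
qed

text \<open>Both \<open>v\<close> and \<open>(F2 ^^ a) v\<close> start sl2 strings: the former for
  the second root with weight \<open>m2\<close>, the latter, killed by \<open>E1\<close>, for the
  first root with weight \<open>m1 + 2 * a\<close>.\<close>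

lemma string_vanishes:
  shows "m1 + 2 * a < b \<Longrightarrow> (F1 ^^ b) ((F2 ^^ a) v) = 0" and "m2 < a \<Longrightarrow> (F2 ^^ a) v = 0"
proof -
  have pow0: "(f ^^ k) 0 = 0" if "f 0 = 0" for f :: "'v \<Rightarrow> 'v" and k by (induction k) (simp_all add: that)
  have beyond: "(f ^^ b) u = 0" if "(f ^^ Suc n) u = 0" "n < b" "f 0 = 0" for f :: "'v \<Rightarrow> 'v" and u n b
  proof -
    have "(f ^^ b) u = (f ^^ (b - Suc n)) ((f ^^ Suc n) u)"
      using that(2) by (simp add: funpow_add[symmetric, THEN fun_cong, unfolded o_apply] del: funpow.simps)
    then show ?thesis using that(1) pow0[of f, OF that(3)] by simp
  qed
  have v0: "v \<in> level 0" using paired.base by (auto simp: level_def)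
  obtain n where "of_nat m2 = (of_nat n :: complex)" "(F2 ^^ Suc n) v = 0"
    by (rule sl2_integral_highest_weight[OF E2.linear_axioms F2.linear_axioms H2.linear_axioms
      E2_F2 H2_F2 E2_v H2_v v_nonzero F_nilpotent(2)[OF v0]])
  then show "m2 < a \<Longrightarrow> (F2 ^^ a) v = 0" using beyond by auto
  show "(F1 ^^ b) ((F2 ^^ a) v) = 0" if "m1 + 2 * a < b"
  proof (cases "(F2 ^^ a) v = 0")
    case True
    then show ?thesis using pow0 by simp
  next
    case False
    have E: "E1 ((F2 ^^ a) v) = 0" by (induction a) (simp_all add: E1_v E1_F2)
    have H: "H1 ((F2 ^^ a) v) = of_nat (m1 + 2 * a) *s (F2 ^^ a) v"
    proof (induction a)
      case (Suc a)
      have "H1 ((F2 ^^ Suc a) v) = of_nat (m1 + 2 * a) *s (F2 ^^ Suc a) v + 2 *s (F2 ^^ Suc a) v"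
        by (simp only: funpow.simps o_apply H1_F2 Suc F2.scale)
      also have "\<dots> = of_nat (m1 + 2 * Suc a) *s (F2 ^^ Suc a) v"
        unfolding scale_left_distrib[symmetric] by (simp add: algebra_simps)
      finally show ?case .
    qed (simp add: H1_v)
    have lev: "(F2 ^^ a) v \<in> level a" by (induction a) (simp_all add: v0 level_F)
    obtain n where "of_nat (m1 + 2 * a) = (of_nat n :: complex)" "(F1 ^^ Suc n) ((F2 ^^ a) v) = 0"
      by (rule sl2_integral_highest_weight[OF E1.linear_axioms F1.linear_axioms H1.linear_axioms
        E1_F1 H1_F1 E H False F_nilpotent(1)[OF lev]])
    then show ?thesis using beyond that by (simp only: of_nat_eq_iff) auto
  qed
qed

text \<open>Formally the polynomial is \<open>(1 + x)^(d - b)\<close> times \<kappa>; the power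
  \<open>b\<close> on the left keeps the exponents nonnegative. In the recursion the
  \<open>Y\<close> term lowers \<open>b\<close> by 1 and the \<open>Z\<close> term by 2, which
  leaves room in both degree bounds.\<close>

lemma insertion_poly_factor:
  "functional \<psi> \<Longrightarrow> \<exists>\<kappa>. [:1, 1:] ^ b * insertion_poly d b \<psi> = [:1, 1:] ^ d * \<kappa> \<and>
     degree \<kappa> \<le> b \<and> 2 * degree \<kappa> \<le> b + m1"
proof (induction d arbitrary: b \<psi>)
  case 0
  have p: "insertion_poly 0 b \<psi> = [:\<psi> ((F1 ^^ b) v):]" by (simp add: insertion_poly_def monom_0)
  show ?case
  \<comment> \<open>Here \<kappa> may have degree \<open>b\<close>, which the second bound permits
    for \<open>b\<close> at most \<open>m1\<close>; beyond that \<open>(F1 ^^ b) v\<close> is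
    0.\<close>
  proof (cases "b \<le> m1")
    case True
    have "degree ([:1, 1:] ^ b * insertion_poly 0 b \<psi>) \<le> b"
      unfolding p using degree_mult_le[of "[:1, 1:] ^ b :: complex poly" "[:\<psi> ((F1 ^^ b) v):]"]
        degree_power_le[of "[:1, 1:] :: complex poly" b] by simp
    then show ?thesis using True by (intro exI[of _ "[:1, 1:] ^ b * insertion_poly 0 b \<psi>"]) simp
  next
    case False
    then have "insertion_poly 0 b \<psi> = 0"
      unfolding p using string_vanishes(1)[of 0 b] functional_zero[OF 0] by simp
    then show ?thesis by (intro exI[of _ 0]) simp
  qed
next
  case (Suc d)
  note comp = functional_comp[OF Suc.prems]
  let ?u = "[:1, 1:] :: complex poly"
  let ?Y = "smult (of_nat b) (insertion_poly d (b - 1) (\<lambda>u. \<psi> (Y u)))"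
  let ?Z = "smult (of_nat (b * (b - 1))) (insertion_poly d (b - 2) (\<lambda>u. \<psi> (Z u)))"
  obtain \<kappa>1 where \<kappa>1: "?u ^ b * insertion_poly d b (\<lambda>u. \<psi> (F2 u)) = ?u ^ d * \<kappa>1"
      "degree \<kappa>1 \<le> b" "2 * degree \<kappa>1 \<le> b + m1"
    using Suc.IH[OF comp(2)] by blast
  obtain \<kappa>2 where \<kappa>2: "?u ^ b * ?Y = ?u ^ Suc d * \<kappa>2" "degree \<kappa>2 \<le> b" "2 * degree \<kappa>2 \<le> b + m1"
  proof (cases b)
    case 0
    then show ?thesis by (intro that[of 0]) simp_all
  next
    case (Suc b')
    obtain \<kappa> where "?u ^ b' * insertion_poly d b' (\<lambda>u. \<psi> (Y u)) = ?u ^ d * \<kappa>"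
      "degree \<kappa> \<le> b'" "2 * degree \<kappa> \<le> b' + m1"
      using Suc.IH[OF comp(3)] by blast
    then show ?thesis
      using Suc by (intro that[of "smult (of_nat b) \<kappa>"]) (simp_all add: mult.assoc del: mult_pCons_left)
  qed
  obtain \<kappa>3 where \<kappa>3: "?u ^ b * ?Z = ?u ^ Suc d * \<kappa>3" "degree \<kappa>3 \<le> b" "2 * degree \<kappa>3 \<le> b + m1"
  proof (cases "b \<le> 1")
    case True
    then have "b * (b - 1) = 0" by (cases b) auto
    then show ?thesis by (intro that[of 0]) simp_all
  next
    case False
    define b' where "b' = b - 2"
    have b: "b = Suc (Suc b')" using False by (simp add: b'_def)
    obtain \<kappa> where \<kappa>: "?u ^ b' * insertion_poly d b' (\<lambda>u. \<psi> (Z u)) = ?u ^ d * \<kappa>"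
      "degree \<kappa> \<le> b'" "2 * degree \<kappa> \<le> b' + m1"
      using Suc.IH[OF comp(4)] by blast
    \<comment> \<open>Lowering \<open>b\<close> by 2 leaves a spare factor \<open>1 + x\<close>. The
      extra degree exactly exhausts the room in the second bound.\<close>
    have "degree (?u * \<kappa>) \<le> Suc (degree \<kappa>)" using degree_mult_le[of ?u \<kappa>] by simp
    moreover have "degree (smult (of_nat (b * (b - 1))) (?u * \<kappa>)) \<le> degree (?u * \<kappa>)"
      by (rule degree_smult_le)
    ultimately have deg: "degree (smult (of_nat (b * (b - 1))) (?u * \<kappa>)) \<le> Suc (degree \<kappa>)"
      by (rule order.trans[rotated])
    have "?u ^ b * insertion_poly d (b - 2) (\<lambda>u. \<psi> (Z u))
        = ?u * (?u * (?u ^ b' * insertion_poly d b' (\<lambda>u. \<psi> (Z u))))"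
      unfolding b'_def[symmetric] by (simp only: b power_Suc mult.assoc)
    also have "\<dots> = ?u ^ Suc d * (?u * \<kappa>)" unfolding \<kappa>(1) by (simp only: power_Suc mult_ac)
    finally have eq: "?u ^ b * insertion_poly d (b - 2) (\<lambda>u. \<psi> (Z u)) = ?u ^ Suc d * (?u * \<kappa>)" .
    show ?thesis
    proof (rule that)
      show "?u ^ b * ?Z = ?u ^ Suc d * smult (of_nat (b * (b - 1))) (?u * \<kappa>)"
        unfolding mult_smult_right eq ..
    qed (use \<kappa>(2,3) b deg in linarith)+
  qed
  have "?u ^ b * insertion_poly (Suc d) b \<psi> = ?u * (?u ^ b * insertion_poly d b (\<lambda>u. \<psi> (F2 u))) + ?u ^ b * ?Y + ?u ^ b * ?Z"
    unfolding insertion_poly_Suc[OF Suc.prems] by (simp add: distrib_left mult.left_commute del: mult_pCons_left)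
  also have "\<dots> = ?u ^ Suc d * (\<kappa>1 + \<kappa>2 + \<kappa>3)"
    unfolding \<kappa>1(1) \<kappa>2(1) \<kappa>3(1) by (simp add: distrib_left mult.assoc del: mult_pCons_left)
  finally have eq: "?u ^ b * insertion_poly (Suc d) b \<psi> = ?u ^ Suc d * (\<kappa>1 + \<kappa>2 + \<kappa>3)" .
  have "degree (\<kappa>1 + \<kappa>2 + \<kappa>3) \<le> n" if "degree \<kappa>1 \<le> n" "degree \<kappa>2 \<le> n" "degree \<kappa>3 \<le> n" for n
    using that by (intro degree_add_le)
  note deg = this
  have "degree (\<kappa>1 + \<kappa>2 + \<kappa>3) \<le> b" by (rule deg[OF \<kappa>1(2) \<kappa>2(2) \<kappa>3(2)])
  moreover have "degree (\<kappa>1 + \<kappa>2 + \<kappa>3) \<le> (b + m1) div 2"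
    by (rule deg) (use \<kappa>1(3) \<kappa>2(3) \<kappa>3(3) in linarith)+
  then have "2 * degree (\<kappa>1 + \<kappa>2 + \<kappa>3) \<le> b + m1" by linarith
  ultimately show ?case using eq by blast
qed

text \<open>The hypothesis \<open>lower\<close> kills the first \<open>c\<close> coefficients of the
  insertion polynomial, hence those of \<kappa>, since \<open>1 + x\<close> is invertible as a power
  series. The degree of \<kappa> is below \<open>c\<close>, so \<kappa> vanishes.\<close>

lemma functional_vanishes_short_middle:
  assumes \<psi>: "functional \<psi>" and "c \<le> d" and b: "b < c \<or> b + m1 < 2 * c"
    and lower: "\<And>c'. c' < c \<Longrightarrow> \<psi> ((F2 ^^ c') ((F1 ^^ b) ((F2 ^^ (d - c')) v))) = 0"
  shows "\<psi> ((F2 ^^ c) ((F1 ^^ b) ((F2 ^^ (d - c)) v))) = 0"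
proof -
  let ?u = "[:1, 1:] :: complex poly" and ?P = "insertion_poly d b \<psi>"
  obtain \<kappa> where \<kappa>: "?u ^ b * ?P = ?u ^ d * \<kappa>" "degree \<kappa> \<le> b" "2 * degree \<kappa> \<le> b + m1"
    using insertion_poly_factor[OF \<psi>] by blast
  have "monom 1 c dvd ?P"
    using lower by (subst monom_1_dvd_iff') (simp add: coeff_insertion_poly)
  then have "monom 1 c dvd ?u ^ d * \<kappa>" unfolding \<kappa>(1)[symmetric] by (rule dvd_mult)
  then have "\<And>k. k < c \<Longrightarrow> coeff (?u ^ d * \<kappa>) k = 0" by (simp add: monom_1_dvd_iff')
  then have "\<And>k. k < c \<Longrightarrow> coeff \<kappa> k = 0" by (rule low_coefficients_cancel)
  moreover have "degree \<kappa> < c" using \<kappa>(2,3) b by linarith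
  ultimately have "\<kappa> = 0" by (metis leading_coeff_0_iff)
  then have "?P = 0" using \<kappa>(1) by simp
  then have "of_nat (d choose c) * \<psi> ((F2 ^^ c) ((F1 ^^ b) ((F2 ^^ (d - c)) v))) = 0"
    using coeff_insertion_poly[of d b \<psi> c] by simp
  then show ?thesis using \<open>c \<le> d\<close> by simp
qed

text \<open>Moving one \<open>F2\<close> left through \<open>F1 ^^ a\<close> costs the coefficients
  \<open>a\<close> and \<open>a * (a - 1)\<close>, so each of the \<open>c\<close> factors raises
  the degree in \<open>a\<close> by at most 2.\<close>

lemma functional_string_poly:
  "functional \<psi> \<Longrightarrow> \<exists>p. degree p \<le> 2 * c \<and>
    (\<forall>a\<le>n. \<psi> ((F1 ^^ a) ((F2 ^^ c) ((F1 ^^ (n - a)) u))) = poly p (of_nat a))"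
proof (induction c arbitrary: \<psi> n)
  case 0
  have "\<psi> ((F1 ^^ a) ((F1 ^^ (n - a)) u)) = \<psi> ((F1 ^^ n) u)" if "a \<le> n" for a
    using that by (simp add: funpow_add[symmetric, THEN fun_cong, unfolded o_apply])
  then show ?case by (intro exI[of _ "[:\<psi> ((F1 ^^ n) u):]"]) simp
next
  case (Suc c)
  note comp = functional_comp[OF Suc.prems]
  let ?g = "\<lambda>\<phi> n a. \<phi> ((F1 ^^ a) ((F2 ^^ c) ((F1 ^^ (n - a)) u))) :: complex"
  obtain p0 where p0: "degree p0 \<le> 2 * c" "\<And>a. a \<le> n \<Longrightarrow> ?g (\<lambda>u. \<psi> (F2 u)) n a = poly p0 (of_nat a)"
    using Suc.IH[OF comp(2)] by metis
  obtain p1 where p1: "degree p1 \<le> 2 * c" "\<And>a. a \<le> n - 1 \<Longrightarrow> ?g (\<lambda>u. \<psi> (Y u)) (n - 1) a = poly p1 (of_nat a)"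
    using Suc.IH[OF comp(3)] by metis
  obtain p2 where p2: "degree p2 \<le> 2 * c" "\<And>a. a \<le> n - 2 \<Longrightarrow> ?g (\<lambda>u. \<psi> (Z u)) (n - 2) a = poly p2 (of_nat a)"
    using Suc.IH[OF comp(4)] by metis
  \<comment> \<open>The \<open>Y\<close> and \<open>Z\<close> terms have totals \<open>n - 1\<close>
    and \<open>n - 2\<close> and are evaluated at \<open>a - 1\<close> and \<open>a - 2\<close>; the
    factors in front vanish where these differences are truncated.\<close>
  define p where "p = p0 + [:0, 1:] * pcompose p1 [:-1, 1:] + [:0, 1:] * ([:-1, 1:] * pcompose p2 [:-2, 1:])"
  have deg: "degree (pcompose q [:r, 1:]) \<le> degree q" for q :: "complex poly" and r
    using degree_pcompose_le[of q "[:r, 1:]"] by simp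
  have lin: "degree ([:r, 1:] * q) \<le> Suc (degree q)" for q :: "complex poly" and r
    using degree_mult_le[of "[:r, 1:]" q] by simp
  have "degree p \<le> 2 * Suc c"
    unfolding p_def using p0(1) p1(1) p2(1) deg[of p1 "-1"] deg[of p2 "-2"]
      lin[of 0 "pcompose p1 [:-1, 1:]"] lin[of 0 "[:-1, 1:] * pcompose p2 [:-2, 1:]"]
      lin[of "-1" "pcompose p2 [:-2, 1:]"]
    by (intro degree_add_le) simp_all
  moreover have "\<psi> ((F1 ^^ a) ((F2 ^^ Suc c) ((F1 ^^ (n - a)) u))) = poly p (of_nat a)" if "a \<le> n" for a
  proof -
    let ?w = "(F2 ^^ c) ((F1 ^^ (n - a)) u)"
    have "\<psi> ((F1 ^^ a) ((F2 ^^ Suc c) ((F1 ^^ (n - a)) u))) =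
        \<psi> (F2 ((F1 ^^ a) ?w)) + of_nat a * \<psi> (Y ((F1 ^^ (a - 1)) ?w)) + of_nat (a * (a - 1)) * \<psi> (Z ((F1 ^^ (a - 2)) ?w))"
      using Suc.prems unfolding functional_def by (simp only: funpow.simps o_apply F1_pow_F2)
    moreover have "\<psi> (F2 ((F1 ^^ a) ?w)) = poly p0 (of_nat a)" using p0(2)[OF that] .
    moreover have "of_nat a * \<psi> (Y ((F1 ^^ (a - 1)) ?w)) = of_nat a * poly p1 (of_nat a - 1)"
    proof (cases a)
      case (Suc a')
      then show ?thesis using p1(2)[of a'] that by simp
    qed simp
    moreover have "of_nat (a * (a - 1)) * \<psi> (Z ((F1 ^^ (a - 2)) ?w)) = of_nat a * ((of_nat a - 1) * poly p2 (of_nat a - 2))"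
    proof (cases "a \<le> 1")
      case True
      then show ?thesis by (cases a) auto
    next
      case False
      define a' where "a' = a - 2"
      have a': "a = a' + 2" using False by (simp add: a'_def)
      then show ?thesis using p2(2)[of a'] that by (simp add: algebra_simps)
    qed
    ultimately have "\<psi> ((F1 ^^ a) ((F2 ^^ Suc c) ((F1 ^^ (n - a)) u))) = poly p0 (of_nat a)
        + of_nat a * poly p1 (of_nat a - 1) + of_nat a * ((of_nat a - 1) * poly p2 (of_nat a - 2))"
      by (simp only:)
    then show ?thesis by (simp add: p_def poly_pcompose left_diff_distrib)
  qed
  ultimately show ?case by blast
qed

text \<open>For fixed \<open>a + b\<close> the values form a polynomial of degree at most
  \<open>2 * c\<close>. It has \<open>min c m1 + 1\<close> zeros from small \<open>a\<close> and
  \<open>max c (2 * c - m1)\<close> from small \<open>b\<close>, together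
  \<open>2 * c + 1\<close>.\<close>

lemma functional_vanishes_strings:
  assumes \<psi>: "functional \<psi>"
    and first: "\<And>a b. a \<le> c \<Longrightarrow> a \<le> m1 \<Longrightarrow> \<psi> ((F1 ^^ a) ((F2 ^^ c) ((F1 ^^ b) u))) = 0"
    and short: "\<And>a b. b < c \<or> b + m1 < 2 * c \<Longrightarrow> \<psi> ((F1 ^^ a) ((F2 ^^ c) ((F1 ^^ b) u))) = 0"
  shows "\<psi> ((F1 ^^ a) ((F2 ^^ c) ((F1 ^^ b) u))) = 0"
proof (rule ccontr)
  assume nz: "\<psi> ((F1 ^^ a) ((F2 ^^ c) ((F1 ^^ b) u))) \<noteq> 0"
  let ?n = "a + b"
  obtain p where p: "degree p \<le> 2 * c"
    "\<And>i. i \<le> ?n \<Longrightarrow> \<psi> ((F1 ^^ i) ((F2 ^^ c) ((F1 ^^ (?n - i)) u))) = poly p (of_nat i)"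
    using functional_string_poly[OF \<psi>] by metis
  define l where "l = min c m1"
  define r where "r = max c (2 * c - m1)"
  have "\<not> (a \<le> c \<and> a \<le> m1)" using nz first by blast
  then have a: "l < a" by (auto simp: l_def)
  have "\<not> (b < c \<or> b + m1 < 2 * c)" using nz short by blast
  then have b: "r \<le> b" by (auto simp: r_def)
  have roots: "poly p (of_nat i) = 0" if "i \<in> {..l} \<union> {Suc ?n - r..?n}" for i
  proof -
    have "\<psi> ((F1 ^^ i) ((F2 ^^ c) ((F1 ^^ (?n - i)) u))) = 0"
    proof (cases "i \<le> l")
      case True
      then show ?thesis by (intro first) (auto simp: l_def)
    next
      case False
      then have "?n - i < r" using that by auto
      then show ?thesis by (intro short) (auto simp: r_def)
    qed
    moreover have "i \<le> ?n" using that a by auto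
    ultimately show ?thesis using p(2)[of i] by simp
  qed
  have "p \<noteq> 0" using nz p(2)[of a] by auto
  \<comment> \<open>At a nonzero value \<open>l < a\<close> and \<open>r \<le> b\<close>, so the two
    ranges of zeros are disjoint and both complete.\<close>
  have "card ({..l} \<union> {Suc ?n - r..?n}) = Suc l + r"
    using a b by (subst card_Un_disjoint) auto
  also have "\<dots> = Suc (2 * c)" by (auto simp: l_def r_def)
  finally have "Suc (2 * c) = card ((of_nat :: nat \<Rightarrow> complex) ` ({..l} \<union> {Suc ?n - r..?n}))"
    by (subst card_image) (auto simp: inj_on_def)
  also have "\<dots> \<le> card {z. poly p z = 0}"
    using roots by (intro card_mono poly_roots_finite[OF \<open>p \<noteq> 0\<close>]) blast
  also have "\<dots> \<le> degree p" by (rule card_poly_roots_bound[OF \<open>p \<noteq> 0\<close>])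
  finally show False using p(1) by simp
qed

lemma functional_vanishes:
  assumes \<psi>: "functional \<psi>" and F: "\<And>a. a \<in> admissible m1 m2 \<Longrightarrow> \<psi> (monomial_op F1 F2 a v) = 0"
  shows "\<psi> (monomial_op F1 F2 a v) = 0"
proof -
  have zero: "(F1 ^^ k) 0 = 0" "(F2 ^^ k) 0 = 0" for k by (induction k) simp_all
  have "c \<le> d \<Longrightarrow> \<psi> ((F1 ^^ a) ((F2 ^^ c) ((F1 ^^ b) ((F2 ^^ (d - c)) v)))) = 0" for a b c d
  proof (induction c arbitrary: a b rule: less_induct)
    case (less c)
    have short: "\<psi> ((F1 ^^ a) ((F2 ^^ c) ((F1 ^^ b) ((F2 ^^ (d - c)) v)))) = 0"
      if "b < c \<or> b + m1 < 2 * c" for a b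
      by (rule functional_vanishes_short_middle[OF functional_comp_pow[OF \<psi>] less.prems that])
        (use less in auto)
    have first: "\<psi> ((F1 ^^ a) ((F2 ^^ c) ((F1 ^^ b) ((F2 ^^ (d - c)) v)))) = 0"
      if "a \<le> c" "a \<le> m1" for a b
    \<comment> \<open>With \<open>a\<close> bounded, the exponent is admissible unless
      \<open>b\<close> is too short for \<open>c\<close>, or one of the two inner strings has
      already ended.\<close>
    proof (cases "d - c \<le> m2 \<and> b \<le> m1 + 2 * (d - c) \<and> \<not> (b < c \<or> b + m1 < 2 * c)")
      case True
      then have "(d - c, b, c, a) \<in> admissible m1 m2" using that by (auto simp: admissible_def)
      then show ?thesis using F by fastforce
    next
      case False
      then consider "b < c \<or> b + m1 < 2 * c" | "m2 < d - c" | "m1 + 2 * (d - c) < b" by linarith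
      then show ?thesis
        by cases (simp_all add: short string_vanishes zero functional_zero[OF \<psi>])
    qed
    show ?case by (rule functional_vanishes_strings[OF \<psi> first short])
  qed
  from this[of "fst (snd (snd a))" "fst a + fst (snd (snd a))" "snd (snd (snd a))" "fst (snd a)"]
  show ?thesis by (cases a) simp
qed

theorem span_admissible_monomials:
  "span ((\<lambda>a. monomial_op F1 F2 a v) ` admissible m1 m2) = UNIV"
proof (rule ccontr)
  let ?S = "(\<lambda>a. monomial_op F1 F2 a v) ` admissible m1 m2"
  assume "span ?S \<noteq> UNIV"
  then obtain a where a: "monomial_op F1 F2 a v \<notin> span ?S"
    using span_all_monomials span_minimal[OF _ subspace_span, of "range (\<lambda>a. monomial_op F1 F2 a v)" ?S]
    by blast
  obtain B where B: "B \<subseteq> ?S" "independent B" "?S \<subseteq> span B"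
    using maximal_independent_subset[of ?S] by blast
  let ?u = "monomial_op F1 F2 a v"
  have "?u \<notin> span B" using a span_mono[OF B(1)] by blast
  then have "independent (insert ?u B)" using B(2) by (rule independent_insertI)
  \<comment> \<open>A functional equal to 1 on the missing monomial and 0 on \<open>B\<close>
    vanishes on all admissible monomials, contrary to \<open>functional_vanishes\<close>.\<close>
  interpret pair: vector_space_pair scale "(*) :: complex \<Rightarrow> complex \<Rightarrow> complex"
    by (intro vector_space_pair.intro vector_space_axioms vector_space_over_itself.vector_space_axioms)
  from pair.linear_independent_extend[OF \<open>independent (insert ?u B)\<close>, of "\<lambda>x. if x = ?u then 1 else 0"]
  obtain \<psi> where \<psi>: "Vector_Spaces.linear scale (*) \<psi>" "\<And>x. x \<in> insert ?u B \<Longrightarrow> \<psi> x = (if x = ?u then 1 else 0)"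
    by blast
  interpret \<psi>: Vector_Spaces.linear scale "(*)" \<psi> by (rule \<psi>(1))
  have "functional \<psi>" by (simp add: functional_def \<psi>.add \<psi>.scale)
  moreover have "\<psi> x = 0" if "x \<in> span B" for x
  proof (rule \<psi>.eq_0_on_span[OF _ that])
    show "\<psi> y = 0" if "y \<in> B" for y using \<psi>(2)[of y] that \<open>?u \<notin> span B\<close> span_base by auto
  qed
  then have "\<psi> (monomial_op F1 F2 a v) = 0" if "a \<in> admissible m1 m2" for a
    using that B(3) by blast
  ultimately have "\<psi> ?u = 0" by (rule functional_vanishes)
  then show False using \<psi>(2)[of ?u] by simp
qed

end

section \<open>Kashiwara-Nakashima tableaux\<close>

definition row_of_counts :: "nat \<Rightarrow> nat \<Rightarrow> nat \<Rightarrow> nat \<Rightarrow> letter list" where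
  "row_of_counts n1 n2 n3 n4 = replicate n1 One @ replicate n2 Two @ replicate n3 Two_bar @ replicate n4 One_bar"

lemma count_list_replicate: "count_list (replicate n x) y = (if x = y then n else 0)"
  by (induction n) auto

lemma count_row_of_counts [simp]:
  "count_list (row_of_counts n1 n2 n3 n4) One = n1" "count_list (row_of_counts n1 n2 n3 n4) Two = n2"
  "count_list (row_of_counts n1 n2 n3 n4) Two_bar = n3" "count_list (row_of_counts n1 n2 n3 n4) One_bar = n4"
  by (simp_all add: row_of_counts_def count_list_replicate)

lemma length_row_of_counts [simp]: "length (row_of_counts n1 n2 n3 n4) = n1 + n2 + n3 + n4"
  by (simp add: row_of_counts_def)

lemma nth_row_of_counts:
  "j < n1 + n2 + n3 + n4 \<Longrightarrow> row_of_counts n1 n2 n3 n4 ! j =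
    (if j < n1 then One else if j < n1 + n2 then Two else if j < n1 + n2 + n3 then Two_bar else One_bar)"
  by (auto simp: row_of_counts_def nth_append)

lemma sorted_row_of_counts: "sorted (row_of_counts n1 n2 n3 n4)"
  by (auto simp: row_of_counts_def sorted_append less_eq_letter_def)

lemma sorted_eq_row_of_counts:
  assumes "sorted xs"
  obtains n1 n2 n3 n4 where "xs = row_of_counts n1 n2 n3 n4"
proof -
  have "\<exists>n1 n2 n3 n4. xs = row_of_counts n1 n2 n3 n4"
    using assms
  proof (induction xs)
    case Nil
    have "([] :: letter list) = row_of_counts 0 0 0 0" by (simp add: row_of_counts_def)
    then show ?case by blast
  next
    case (Cons x xs)
    then obtain n1 n2 n3 n4 where xs: "xs = row_of_counts n1 n2 n3 n4" by auto
    have le: "n1 > 0 \<Longrightarrow> x \<le> One" "n2 > 0 \<Longrightarrow> x \<le> Two" "n3 > 0 \<Longrightarrow> x \<le> Two_bar"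
      using Cons.prems by (auto simp: xs row_of_counts_def)
    show ?case
    proof (cases x)
      case One
      then have "x # xs = row_of_counts (Suc n1) n2 n3 n4" by (simp add: xs row_of_counts_def)
      then show ?thesis by blast
    next
      case Two
      then have "n1 = 0" using le by (auto simp: less_eq_letter_def)
      then have "x # xs = row_of_counts 0 (Suc n2) n3 n4" using Two by (simp add: xs row_of_counts_def)
      then show ?thesis by blast
    next
      case Two_bar
      then have "n1 = 0" "n2 = 0" using le by (auto simp: less_eq_letter_def)
      then have "x # xs = row_of_counts 0 0 (Suc n3) n4" using Two_bar by (simp add: xs row_of_counts_def)
      then show ?thesis by blast
    next
      case One_bar
      then have "n1 = 0" "n2 = 0" "n3 = 0" using le by (auto simp: less_eq_letter_def)
      then have "x # xs = row_of_counts 0 0 0 (Suc n4)" using One_bar by (simp add: xs row_of_counts_def)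
      then show ?thesis by blast
    qed
  qed
  then show ?thesis using that by blast
qed

text \<open>The conditions on columns force the number \<open>b\<close> of letters \<open>One_bar\<close> in the second row: at
  most one column is \<open>Two\<close> over \<open>Two_bar\<close>, so \<open>a2 - m1\<close> (truncated) is \<open>2 * b\<close> or \<open>2 * b + 1\<close>.\<close>

fun tableau_of :: "nat \<Rightarrow> nat \<Rightarrow> nat \<times> nat \<times> nat \<times> nat \<Rightarrow> tableau" where
  "tableau_of m1 m2 (a1, a2, a3, a4) = (let b = (a2 - m1) div 2 in
     (row_of_counts (m1 + m2 + b - a2) (a2 - a3 - b) (a3 - a4) a4, row_of_counts 0 (m2 - a1) (a1 - b) b))"

lemma letter_less [simp]:
  "One < Two" "One < Two_bar" "One < One_bar" "Two < Two_bar" "Two < One_bar" "Two_bar < One_bar"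
  by (simp_all add: less_letter_def)

text \<open>A \<open>Two\<close> below lies under \<open>One\<close>, a \<open>Two_bar\<close> below
  under \<open>One\<close> or \<open>Two\<close>, and a \<open>One_bar\<close> below not under
  \<open>One\<close>; a \<open>One_bar\<close> above is in a column of length 1. The forbidden
  configurations leave at most one column \<open>Two\<close> over \<open>Two_bar\<close>, which is
  the last inequality.\<close>

lemma row_of_counts_pair_KN_iff:
  "(row_of_counts p1 p2 p3 p4, row_of_counts 0 q2 q3 q4) \<in> KN_tableaux (m1 + m2) m2 \<longleftrightarrow>
    p1 + p2 + p3 + p4 = m1 + m2 \<and> q2 + q3 + q4 = m2 \<and> q2 \<le> p1 \<and> (q4 > 0 \<longrightarrow> p1 \<le> q2 + q3) \<and>
    q2 + q3 \<le> p1 + p2 \<and> p4 \<le> m1 \<and> q2 + q3 \<le> Suc p1"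
  (is "?T \<in> ?K \<longleftrightarrow> ?C")
proof
  let ?r = "row_of_counts p1 p2 p3 p4" and ?s = "row_of_counts 0 q2 q3 q4"
  assume "?T \<in> ?K"
  then have sizes: "p1 + p2 + p3 + p4 = m1 + m2" "q2 + q3 + q4 = m2"
    and strict: "\<And>j. j < m2 \<Longrightarrow> ?r ! j < ?s ! j"
    and no_pair: "\<And>j. j < m2 \<Longrightarrow> \<not> {One, One_bar} \<subseteq> {?r ! j, ?s ! j}"
    and forbidden: "\<And>j. j + 1 < m2 \<Longrightarrow> \<not> (?r ! j = Two \<and> ?r ! (j + 1) = Two \<and> ?s ! (j + 1) = Two_bar)"
    unfolding KN_tableaux_def by auto
  have r: "?r ! j = (if j < p1 then One else if j < p1 + p2 then Two else if j < p1 + p2 + p3 then Two_bar else One_bar)"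
    and s: "?s ! j = (if j < q2 then Two else if j < q2 + q3 then Two_bar else One_bar)" if "j < m2" for j
    using that sizes by (simp_all add: nth_row_of_counts)
  have "q2 \<le> p1"
  proof (cases q2)
    case (Suc j)
    then show ?thesis using strict[of j] r[of j] s[of j] sizes by (auto simp: less_letter_def split: if_splits)
  qed simp
  moreover have "p1 \<le> q2 + q3" if "q4 > 0"
    using no_pair[of "q2 + q3"] r[of "q2 + q3"] s[of "q2 + q3"] sizes that by (auto split: if_splits)
  moreover have "q2 + q3 \<le> p1 + p2"
  proof (cases "q2 + q3")
    case (Suc j)
    then show ?thesis using strict[of j] r[of j] s[of j] sizes by (auto simp: less_letter_def split: if_splits)
  qed simp
  moreover have "p4 \<le> m1"
  proof (cases m2)
    case (Suc j)
    then show ?thesis using strict[of j] r[of j] s[of j] sizes by (auto simp: less_letter_def split: if_splits)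
  qed (use sizes in simp)
  moreover have "q2 + q3 \<le> Suc p1"
  proof (rule ccontr)
    assume *: "\<not> q2 + q3 \<le> Suc p1"
    \<comment> \<open>Columns \<open>j\<close> and \<open>j + 1\<close> are the last two whose lower
      entry is not \<open>One_bar\<close>; their upper entries are \<open>Two\<close>.\<close>
    define j where "j = q2 + q3 - 2"
    have j: "p1 \<le> j" "j + 1 < q2 + q3" using * by (auto simp: j_def)
    moreover note \<open>q2 \<le> p1\<close> \<open>q2 + q3 \<le> p1 + p2\<close>
    ultimately show False
      using forbidden[of j] r[of j] r[of "j + 1"] s[of "j + 1"] sizes by simp
  qed
  ultimately show ?C using sizes by blast
next
  assume C: ?C
  let ?r = "row_of_counts p1 p2 p3 p4" and ?s = "row_of_counts 0 q2 q3 q4"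
  have r: "?r ! j = (if j < p1 then One else if j < p1 + p2 then Two else if j < p1 + p2 + p3 then Two_bar else One_bar)"
    and s: "?s ! j = (if j < q2 then Two else if j < q2 + q3 then Two_bar else One_bar)" if "j < m2" for j
    using that C by (simp_all add: nth_row_of_counts)
  have "?r ! j < ?s ! j \<and> \<not> {One, One_bar} \<subseteq> {?r ! j, ?s ! j}" if "j < m2" for j
    using that C unfolding r[OF that] s[OF that] by auto
  moreover have "\<not> (?r ! j = Two \<and> ?r ! (j + 1) = Two \<and> ?s ! (j + 1) = Two_bar) \<and>
      \<not> (?r ! j = Two \<and> ?s ! j = Two_bar \<and> ?s ! (j + 1) = Two_bar)" if "j + 1 < m2" for j
  proof -
    have "j < m2" using that by simp
    show ?thesis
      using C unfolding r[OF that] s[OF that] r[OF \<open>j < m2\<close>] s[OF \<open>j < m2\<close>] by auto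
  qed
  ultimately show "?T \<in> ?K"
    unfolding KN_tableaux_def using C by (simp add: sorted_row_of_counts)
qed

text \<open>This replaces truncated subtraction and division by linear cases, as
  \<open>linarith\<close> needs.\<close>

lemma half_excess:
  fixes x m :: nat
  obtains t where "t \<le> 1" "x \<le> m \<and> (x - m) div 2 = 0 \<or> x = m + 2 * ((x - m) div 2) + t"
proof (cases "x \<le> m")
  case False
  have "x = m + 2 * ((x - m) div 2) + (x - m) mod 2"
    using False mult_div_mod_eq[of 2 "x - m"] by linarith
  then show ?thesis using that[of "(x - m) mod 2"] by simp
qed (use that[of 0] in simp)

theorem bij_betw_tableau_of:
  "bij_betw (tableau_of m1 m2) (admissible m1 m2) (KN_tableaux (m1 + m2) m2)"
proof (rule bij_betwI')
  fix a a' assume "a \<in> admissible m1 m2" "a' \<in> admissible m1 m2"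
  moreover obtain a1 a2 a3 a4 where a: "a = (a1, a2, a3, a4)" by (cases a)
  moreover obtain a1' a2' a3' a4' where a': "a' = (a1', a2', a3', a4')" by (cases a')
  ultimately have adm: "(a1, a2, a3, a4) \<in> admissible m1 m2" "(a1', a2', a3', a4') \<in> admissible m1 m2" by simp_all
  have eq: "p1 = q1 \<and> p2 = q2 \<and> p3 = q3 \<and> p4 = q4" if "row_of_counts p1 p2 p3 p4 = row_of_counts q1 q2 q3 q4"
    for p1 p2 p3 p4 q1 q2 q3 q4 using that by (metis count_row_of_counts)
  show "(tableau_of m1 m2 a = tableau_of m1 m2 a') = (a = a')"
  proof
    assume "tableau_of m1 m2 a = tableau_of m1 m2 a'"
    then have e: "m1 + m2 + (a2 - m1) div 2 - a2 = m1 + m2 + (a2' - m1) div 2 - a2'"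
       "a3 - a4 = a3' - a4'" "a4 = a4'" "m2 - a1 = m2 - a1'" "(a2 - m1) div 2 = (a2' - m1) div 2"
      unfolding a a' tableau_of.simps Let_def by (auto dest!: eq)
    from adm have b: "a4 \<le> a3" "a4' \<le> a3'" "a1 \<le> m2" "a1' \<le> m2" "a2 \<le> m1 + 2 * a1" "a2' \<le> m1 + 2 * a1'"
      by (auto simp: admissible_def)
    have "a3 = a3'" using e(2,3) b(1,2) by linarith
    moreover have "a1 = a1'" using e(4) b(3,4) by linarith
    \<comment> \<open>This rules out truncation in the number of letters \<open>One\<close>, from
      which \<open>a2\<close> is recovered.\<close>
    moreover have "x \<le> m1 + m2 + (x - m1) div 2" if "x \<le> m1 + 2 * y" "y \<le> m2" for x y
      by (rule half_excess[of x m1]) (use that in linarith)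
    from this[OF b(5,3)] this[OF b(6,4)] have "a2 = a2'" using e(1,5) by linarith
    moreover note \<open>a4 = a4'\<close>
    ultimately show "a = a'" by (simp add: a a')
  qed simp
next
  fix a assume "a \<in> admissible m1 m2"
  moreover obtain a1 a2 a3 a4 where a: "a = (a1, a2, a3, a4)" by (cases a)
  ultimately have adm: "a1 \<le> m2" "a2 \<le> m1 + 2 * a1" "a3 \<le> a2" "2 * a3 \<le> a2 + m1" "a4 \<le> m1" "a4 \<le> a3"
    by (auto simp: admissible_def)
  show "tableau_of m1 m2 a \<in> KN_tableaux (m1 + m2) m2"
    unfolding a tableau_of.simps Let_def row_of_counts_pair_KN_iff
  proof -
    define b where "b = (a2 - m1) div 2"
    have b: "a2 \<le> m1 + m2 + b" "b \<le> a1" "a3 + b \<le> a2" "a3 \<le> m1 + b" "a2 \<le> m1 + b + a1"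
      "0 < b \<longrightarrow> m1 + 2 * b \<le> a2" "a2 \<le> m1 + 2 * b + 1"
      unfolding b_def by (rule half_excess[of a2 m1], use adm in linarith)+
    then show "m1 + m2 + b - a2 + (a2 - a3 - b) + (a3 - a4) + a4 = m1 + m2 \<and>
      m2 - a1 + (a1 - b) + b = m2 \<and> m2 - a1 \<le> m1 + m2 + b - a2 \<and>
      (0 < b \<longrightarrow> m1 + m2 + b - a2 \<le> m2 - a1 + (a1 - b)) \<and>
      m2 - a1 + (a1 - b) \<le> m1 + m2 + b - a2 + (a2 - a3 - b) \<and> a4 \<le> m1 \<and>
      m2 - a1 + (a1 - b) \<le> Suc (m1 + m2 + b - a2)"
      using adm by (intro conjI impI; linarith)
  qed
next
  fix T assume T: "T \<in> KN_tableaux (m1 + m2) m2"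
  obtain r s where rs: "T = (r, s)" by (cases T)
  then have "sorted r" "sorted s" and strict: "\<And>j. j < m2 \<Longrightarrow> r ! j < s ! j" and len: "length s = m2"
    using T by (auto simp: KN_tableaux_def)
  obtain p1 p2 p3 p4 where r: "r = row_of_counts p1 p2 p3 p4" using sorted_eq_row_of_counts[OF \<open>sorted r\<close>] .
  obtain q1 q2 q3 q4 where s: "s = row_of_counts q1 q2 q3 q4" using sorted_eq_row_of_counts[OF \<open>sorted s\<close>] .
  have "q1 = 0"
  proof (rule ccontr)
    assume "q1 \<noteq> 0"
    then have "0 < m2" "s ! 0 = One" using len by (simp_all add: s nth_row_of_counts)
    then show False using strict[of 0] by (cases "r ! 0") (auto simp: less_letter_def)
  qed
  then have C: "p1 + p2 + p3 + p4 = m1 + m2" "q2 + q3 + q4 = m2" "q2 \<le> p1" "q4 > 0 \<longrightarrow> p1 \<le> q2 + q3"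
    "q2 + q3 \<le> p1 + p2" "p4 \<le> m1" "q2 + q3 \<le> Suc p1"
    using T row_of_counts_pair_KN_iff[of p1 p2 p3 p4 q2 q3 q4 m1 m2] unfolding rs r s by blast+
  \<comment> \<open>The inverse map: \<open>a2\<close> counts the entries of the first row other
    than \<open>One\<close>, plus the letters \<open>One_bar\<close> of the second row.\<close>
  define a2 where "a2 = p2 + p3 + p4 + q4"
  \<comment> \<open>For \<open>q4 > 0\<close> the difference \<open>a2 - m1 - 2 * q4\<close> is
    \<open>q2 + q3 - p1\<close>, the number of columns \<open>Two\<close> over
    \<open>Two_bar\<close>, hence 0 or 1.\<close>
  have "a2 - m1 = 2 * q4 \<or> a2 - m1 = 2 * q4 + 1"
  proof (cases "q4 = 0")
    case True
    then have "a2 \<le> m1 + 1" using C unfolding a2_def by linarith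
    then show ?thesis using True by linarith
  next
    case False
    then show ?thesis using C unfolding a2_def by linarith
  qed
  then have q4: "(a2 - m1) div 2 = q4" by auto
  have "(q3 + q4, a2, p3 + p4, p4) \<in> admissible m1 m2"
    using C unfolding admissible_def a2_def by auto
  moreover have "T = tableau_of m1 m2 (q3 + q4, a2, p3 + p4, p4)"
  proof -
    have "m1 + m2 + q4 - a2 = p1" "a2 - (p3 + p4) - q4 = p2" "p3 + p4 - p4 = p3"
      "m2 - (q3 + q4) = q2" "q3 + q4 - q4 = q3"
      using C(1,2) unfolding a2_def by linarith+
    then show ?thesis unfolding rs r s tableau_of.simps Let_def q4 \<open>q1 = 0\<close> by simp
  qed
  ultimately show "\<exists>a\<in>admissible m1 m2. T = tableau_of m1 m2 a" by blast
qed

text \<open>The subtracted terms are multiples of the simple roots, so this is the weight of the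
  monomial vector with the same exponents.\<close>

lemma wt_tableau_of:
  assumes "(a1, a2, a3, a4) \<in> admissible m1 m2"
  shows "wt (tableau_of m1 m2 (a1, a2, a3, a4)) H = dominant_weight m1 m2 H
    - of_nat (a2 + a4) * (eps1 H - eps2 H) - of_nat (a1 + a3) * (2 * eps2 H)"
proof -
  define b where "b = (a2 - m1) div 2"
  have adm: "a1 \<le> m2" "a2 \<le> m1 + 2 * a1" "a3 \<le> a2" "2 * a3 \<le> a2 + m1" "a4 \<le> m1" "a4 \<le> a3"
    using assms by (auto simp: admissible_def)
  have le: "a2 \<le> m1 + m2 + b" "b \<le> a1" "a3 + b \<le> a2" unfolding b_def by (rule half_excess[of a2 m1], use adm in linarith)+
  have "wt (tableau_of m1 m2 (a1, a2, a3, a4)) H =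
     (of_nat (m1 + m2 + b - a2) - (of_nat a4 + of_nat b)) * eps1 H
     + (of_nat (a2 - a3 - b) + of_nat (m2 - a1) - (of_nat (a3 - a4) + of_nat (a1 - b))) * eps2 H"
    by (simp add: wt_def multiplicity_in_def Let_def b_def)
  moreover have "of_nat (m1 + m2 + b - a2) = (of_nat m1 + of_nat m2 + of_nat b - of_nat a2 :: complex)"
    using of_nat_diff[OF le(1), where 'a = complex] by simp
  moreover have "of_nat (a2 - a3 - b) = (of_nat a2 - of_nat a3 - of_nat b :: complex)"
    using of_nat_diff[OF le(3), where 'a = complex] by simp
  moreover note of_nat_diff[OF adm(1), where 'a = complex] of_nat_diff[OF adm(6), where 'a = complex]
    of_nat_diff[OF le(2), where 'a = complex]
  moreover have "(x1 + x2 + b - a2 - (a4 + b)) * p + (a2 - a3 - b + (x2 - a1) - (a3 - a4 + (a1 - b))) * q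
     = x1 * p + x2 * (p + q) - (a2 + a4) * (p - q) - (a1 + a3) * (2 * q)"
    for x1 x2 a1 a2 a3 a4 b p q :: complex by algebra
  ultimately show ?thesis
    by (simp only: dominant_weight_def omega1_def omega2_def of_nat_add)
qed

section \<open>Matrices\<close>

lemma vector_4:
  "(vector [x, y, z, w] :: 'a::zero^4) $ 1 = x" "(vector [x, y, z, w] :: 'a::zero^4) $ 2 = y"
  "(vector [x, y, z, w] :: 'a::zero^4) $ 3 = z" "(vector [x, y, z, w] :: 'a::zero^4) $ 4 = w"
  unfolding vector_def by simp_all

lemma sp4_iff:
  "X \<in> sp4 \<longleftrightarrow> X$3$3 = - X$1$1 \<and> X$3$4 = - X$2$1 \<and> X$4$3 = - X$1$2 \<and> X$4$4 = - X$2$2 \<and>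
    X$1$4 = X$2$3 \<and> X$3$2 = X$4$1"
proof
  assume "X \<in> sp4"
  then obtain A B C where X: "X = block_matrix A B C (- transpose A)" "transpose B = B" "transpose C = C"
    by (auto simp: sp4_def)
  from X(2,3) have "B$1$2 = B$2$1" "C$1$2 = C$2$1" by (auto simp: vec_eq_iff transpose_def)
  then show "X$3$3 = - X$1$1 \<and> X$3$4 = - X$2$1 \<and> X$4$3 = - X$1$2 \<and> X$4$4 = - X$2$2 \<and>
    X$1$4 = X$2$3 \<and> X$3$2 = X$4$1"
    by (simp add: X(1) block_matrix_def vector_4 transpose_def)
next
  assume X: "X$3$3 = - X$1$1 \<and> X$3$4 = - X$2$1 \<and> X$4$3 = - X$1$2 \<and> X$4$4 = - X$2$2 \<and>
    X$1$4 = X$2$3 \<and> X$3$2 = X$4$1"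
  define A B C :: "complex^2^2" where "A = vector [vector [X$1$1, X$1$2], vector [X$2$1, X$2$2]]"
    and "B = vector [vector [X$1$3, X$1$4], vector [X$2$3, X$2$4]]"
    and "C = vector [vector [X$3$1, X$3$2], vector [X$4$1, X$4$2]]"
  have "X = block_matrix A B C (- transpose A)"
    using X by (simp add: vec_eq_iff forall_4 block_matrix_def vector_4 A_def B_def C_def transpose_def)
  moreover have "transpose B = B" "transpose C = C"
    using X by (simp_all add: B_def C_def vec_eq_iff forall_2 transpose_def)
  ultimately show "X \<in> sp4" unfolding sp4_def by blast
qed

lemmas matrix_entry_simps = lie_bracket_def matrix_scale_def matrix_matrix_mult_def sum_4
  e1_def f1_def e2_def f2_def elementary_def

lemma sp4_lie_bracket: "X \<in> sp4 \<Longrightarrow> Y \<in> sp4 \<Longrightarrow> lie_bracket X Y \<in> sp4"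
  unfolding sp4_iff by (simp add: lie_bracket_def matrix_matrix_mult_def sum_4)

lemma sp4_add: "X \<in> sp4 \<Longrightarrow> Y \<in> sp4 \<Longrightarrow> X + Y \<in> sp4"
  unfolding sp4_iff by simp

lemma sp4_scale: "X \<in> sp4 \<Longrightarrow> matrix_scale c X \<in> sp4"
  unfolding sp4_iff by (simp add: matrix_scale_def)

lemma sp4_generators: "e1 \<in> sp4" "e2 \<in> sp4" "f1 \<in> sp4" "f2 \<in> sp4"
  unfolding sp4_iff by (simp_all add: matrix_entry_simps)

abbreviation h1 :: "complex^4^4" where "h1 \<equiv> lie_bracket e1 f1"
abbreviation h2 :: "complex^4^4" where "h2 \<equiv> lie_bracket e2 f2"
abbreviation root_y :: "complex^4^4" where "root_y \<equiv> lie_bracket f1 f2"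
abbreviation root_z :: "complex^4^4" where "root_z \<equiv> matrix_scale (1/2) (lie_bracket f1 root_y)"

text \<open>Zero brackets are written as multiples by 0 so that all relations fit
  \<open>rho_bracket_scaled\<close>.\<close>

lemma sp4_relations:
  "lie_bracket e1 f2 = matrix_scale 0 f1" "lie_bracket e2 f1 = matrix_scale 0 f1"
  "lie_bracket h1 f1 = matrix_scale (- 2) f1" "lie_bracket h1 f2 = matrix_scale 2 f2"
  "lie_bracket h2 f1 = matrix_scale 1 f1" "lie_bracket h2 f2 = matrix_scale (- 2) f2"
  "lie_bracket h1 e1 = matrix_scale 2 e1" "lie_bracket h1 e2 = matrix_scale (- 2) e2"
  "lie_bracket h2 e1 = matrix_scale (- 1) e1" "lie_bracket h2 e2 = matrix_scale 2 e2"
  "lie_bracket f1 root_z = matrix_scale 0 f1" "lie_bracket f2 root_y = matrix_scale 0 f1"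
  "lie_bracket f2 root_z = matrix_scale 0 f1" "lie_bracket f1 root_y = matrix_scale 2 root_z"
  by (simp_all add: vec_eq_iff forall_4 matrix_entry_simps)

text \<open>All ten root and Cartan vectors are iterated brackets of \<open>e1, e2, f1, f2\<close>,
  so these generate the Lie algebra.\<close>

lemma sp4_decomposition:
  assumes "X \<in> sp4"
  shows "X = matrix_scale (X$1$1) h1 + (matrix_scale (X$1$1 + X$2$2) h2 + (matrix_scale (X$1$2) e1
    + (matrix_scale (X$2$1) f1 + (matrix_scale (X$2$4) e2 + (matrix_scale (X$4$2) f2
    + (matrix_scale (X$1$4) (lie_bracket e1 e2) + (matrix_scale (X$1$3 / 2) (lie_bracket e1 (lie_bracket e1 e2))
    + (matrix_scale (- X$4$1) root_y + matrix_scale (X$3$1) root_z))))))))"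
  using assms unfolding sp4_iff by (simp add: vec_eq_iff forall_4 matrix_entry_simps)

lemma cartan_iff: "H \<in> cartan \<longleftrightarrow> H \<in> sp4 \<and> (\<forall>i j. i \<noteq> j \<longrightarrow> H$i$j = 0)"
  by (simp add: cartan_def)

lemma cartan_brackets:
  assumes "H \<in> cartan"
  shows "lie_bracket H f1 = matrix_scale (eps2 H - eps1 H) f1"
    and "lie_bracket H f2 = matrix_scale (- 2 * eps2 H) f2"
proof -
  have H: "H$3$3 = - H$1$1" "H$4$4 = - H$2$2" "\<And>i j. i \<noteq> j \<Longrightarrow> H$i$j = 0"
    using assms by (auto simp: cartan_iff sp4_iff)
  show "lie_bracket H f1 = matrix_scale (eps2 H - eps1 H) f1"
    "lie_bracket H f2 = matrix_scale (- 2 * eps2 H) f2"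
    by (simp_all add: vec_eq_iff forall_4 matrix_entry_simps eps1_def eps2_def H)
qed

lemma h_cartan: "h1 \<in> cartan" "h2 \<in> cartan"
proof -
  have "h1 \<in> sp4" "h2 \<in> sp4" by (simp_all add: sp4_lie_bracket sp4_generators)
  then show "h1 \<in> cartan" "h2 \<in> cartan"
    by (simp_all add: cartan_iff forall_4 matrix_entry_simps)
qed

lemma dominant_weight_h: "dominant_weight m1 m2 h1 = of_nat m1" "dominant_weight m1 m2 h2 = of_nat m2"
  by (simp_all add: dominant_weight_def omega1_def omega2_def eps1_def eps2_def matrix_entry_simps)

section \<open>From representations to the Chevalley generators\<close>

context sp4_representation
begin

lemma rho_bracket_scaled:
  assumes "X \<in> sp4" "Y \<in> sp4" "Z \<in> sp4" "lie_bracket X Y = matrix_scale c Z"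
  shows "rho X (rho Y u) = rho Y (rho X u) + scale c (rho Z u)"
  using rho_bracket[OF assms(1,2), of u] rho_scale[OF assms(3), of c u] assms(4) by simp

text \<open>The elements that preserve \<open>W\<close> form a Lie subalgebra, and it contains the
  generators. This carries irreducibility over to the condition in \<open>hw_irrep\<close>.\<close>

lemma generated_subrepresentation:
  assumes W: "subspace W"
    and gen: "\<And>u. u \<in> W \<Longrightarrow> rho e1 u \<in> W \<and> rho e2 u \<in> W \<and> rho f1 u \<in> W \<and> rho f2 u \<in> W"
    and X: "X \<in> sp4" and u: "u \<in> W"
  shows "rho X u \<in> W"
proof -
  define G where "G = {X \<in> sp4. \<forall>u\<in>W. rho X u \<in> W}"
  have add: "X + Y \<in> G" if "X \<in> G" "Y \<in> G" for X Y
    using that W by (auto simp: G_def sp4_add rho_add subspace_add)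
  have scale: "matrix_scale c X \<in> G" if "X \<in> G" for X c
    using that W by (auto simp: G_def sp4_scale rho_scale subspace_scale)
  have bracket: "lie_bracket X Y \<in> G" if "X \<in> G" "Y \<in> G" for X Y
    using that W by (auto simp: G_def sp4_lie_bracket rho_bracket subspace_diff)
  have "e1 \<in> G" "e2 \<in> G" "f1 \<in> G" "f2 \<in> G"
    using gen by (auto simp: G_def sp4_generators)
  then have "X \<in> G" by (subst sp4_decomposition[OF X]) (intro add scale bracket)
  then show ?thesis using u by (simp add: G_def)
qed

lemma rho_cartan_pow:
  assumes "H \<in> cartan" "rho H u = scale c u"
  shows "rho H ((rho f1 ^^ n) u) = scale (c - of_nat n * (eps1 H - eps2 H)) ((rho f1 ^^ n) u)"
    and "rho H ((rho f2 ^^ n) u) = scale (c - of_nat n * (2 * eps2 H)) ((rho f2 ^^ n) u)"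
proof -
  have H: "H \<in> sp4" using assms(1) by (simp add: cartan_def)
  have lin: "rho X (scale c w) = scale c (rho X w)" if "X \<in> sp4" for X c w
    using rho_linear[OF that] by (simp add: Vector_Spaces.linear_iff)
  show "rho H ((rho f1 ^^ n) u) = scale (c - of_nat n * (eps1 H - eps2 H)) ((rho f1 ^^ n) u)"
  proof (induction n)
    case (Suc n)
    have "rho H ((rho f1 ^^ Suc n) u)
        = scale (c - of_nat n * (eps1 H - eps2 H) + (eps2 H - eps1 H)) ((rho f1 ^^ Suc n) u)"
      using rho_bracket_scaled[OF H sp4_generators(3,3) cartan_brackets(1)[OF assms(1)], of "(rho f1 ^^ n) u"]
      by (simp only: funpow.simps o_apply Suc lin[OF sp4_generators(3)] scale_left_distrib)
    also have "c - of_nat n * (eps1 H - eps2 H) + (eps2 H - eps1 H) = c - of_nat (Suc n) * (eps1 H - eps2 H)"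
      by (simp add: algebra_simps)
    finally show ?case .
  qed (simp add: assms(2))
  show "rho H ((rho f2 ^^ n) u) = scale (c - of_nat n * (2 * eps2 H)) ((rho f2 ^^ n) u)"
  proof (induction n)
    case (Suc n)
    have "rho H ((rho f2 ^^ Suc n) u)
        = scale (c - of_nat n * (2 * eps2 H) + (- 2 * eps2 H)) ((rho f2 ^^ Suc n) u)"
      using rho_bracket_scaled[OF H sp4_generators(4,4) cartan_brackets(2)[OF assms(1)], of "(rho f2 ^^ n) u"]
      by (simp only: funpow.simps o_apply Suc lin[OF sp4_generators(4)] scale_left_distrib)
    also have "c - of_nat n * (2 * eps2 H) + (- 2 * eps2 H) = c - of_nat (Suc n) * (2 * eps2 H)"
      by (simp add: algebra_simps)
    finally show ?case .
  qed (simp add: assms(2))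
qed

end

context sp4_irrep
begin

lemma chevalley_action:
  "sp4_hw_irrep scale (rho e1) (rho e2) (rho f1) (rho f2) (rho h1) (rho h2) v m1 m2 (rho root_y) (rho root_z)"
proof -
  note mem = sp4_generators sp4_lie_bracket sp4_scale
  have hw: "v \<noteq> 0" "\<And>H. H \<in> cartan \<Longrightarrow> rho H v = scale (dominant_weight m1 m2 H) v" "rho e1 v = 0" "rho e2 v = 0"
    using highest_weight_vector by (auto simp: highest_weight_vector_def weight_vector_def)
  show ?thesis
  proof (intro sp4_hw_irrep.intro hw_irrep.intro hw_module.intro chevalley_module.intro complex_vector_space.intro
        vector_space_axioms rho_linear mem)
    show "chevalley_module_axioms scale (rho e1) (rho e2) (rho f1) (rho f2) (rho h1) (rho h2)"
      using sp4_relations(1-10)[THEN rho_bracket_scaled[rotated 3]]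
      by unfold_locales (simp_all add: mem rho_bracket)
    show "hw_module_axioms scale (rho e1) (rho e2) (rho h1) (rho h2) v m1 m2"
      by unfold_locales (simp_all add: hw h_cartan dominant_weight_h)
    show "hw_irrep_axioms scale (rho e1) (rho e2) (rho f1) (rho f2)"
    proof
      show "\<exists>B. finite B \<and> span B = UNIV" using finite_dim by (simp add: finite_dim_def)
      show "W = {0} \<or> W = UNIV"
        if "subspace W" "\<And>u. u \<in> W \<Longrightarrow> rho e1 u \<in> W \<and> rho e2 u \<in> W \<and> rho f1 u \<in> W \<and> rho f2 u \<in> W" for W
        using irreducible generated_subrepresentation[OF that] that(1) unfolding irreducible_def by blast
    qed
    show "sp4_hw_irrep_axioms scale (rho f1) (rho f2) (rho root_y) (rho root_z)"
      using sp4_relations(11-14)[THEN rho_bracket_scaled[rotated 3]]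
      by unfold_locales (simp_all add: mem rho_bracket)
  qed
qed

lemma weight_monomial:
  assumes "H \<in> cartan" "a = (a1, a2, a3, a4)"
  shows "rho H (monomial_op (rho f1) (rho f2) a v) = scale (dominant_weight m1 m2 H
    - of_nat (a2 + a4) * (eps1 H - eps2 H) - of_nat (a1 + a3) * (2 * eps2 H)) (monomial_op (rho f1) (rho f2) a v)"
proof -
  have v: "rho H v = scale (dominant_weight m1 m2 H) v"
    using highest_weight_vector assms(1) by (simp add: highest_weight_vector_def weight_vector_def)
  note pow = rho_cartan_pow[OF assms(1)]
  have "x - p1 * g - p2 * f - p3 * g - p4 * f = x - (p2 + p4) * f - (p1 + p3) * g"
    for x p1 p2 p3 p4 f g :: complex by algebra
  with pow(1)[OF pow(2)[OF pow(1)[OF pow(2)[OF v]]], of a4 a3 a2 a1]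
  show ?thesis by (simp only: assms(2) monomial_op.simps of_nat_add)
qed

end

lemma admissible_real:
  "(a1, a2, a3, a4) \<in> admissible m1 m2 \<longleftrightarrow> a1 \<le> m2 \<and> a2 \<le> m1 + 2 * a1 \<and>
    real a3 \<le> min ((1/2) * (real a2 + real m1)) (real a2) \<and> a4 \<le> min m1 a3"
  unfolding admissible_def by auto

lemma monomial_vectors_eq:
  "monomial_vectors rho m1 m2 v = (\<lambda>a. monomial_op (rho f1) (rho f2) a v) ` admissible m1 m2"
proof (intro equalityI subsetI)
  fix w assume "w \<in> monomial_vectors rho m1 m2 v"
  then obtain a1 a2 a3 a4 where "w = monomial_op (rho f1) (rho f2) (a1, a2, a3, a4) v"
    "(a1, a2, a3, a4) \<in> admissible m1 m2"
    unfolding monomial_vectors_def admissible_real by auto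
  then show "w \<in> (\<lambda>a. monomial_op (rho f1) (rho f2) a v) ` admissible m1 m2" by blast
next
  fix w assume "w \<in> (\<lambda>a. monomial_op (rho f1) (rho f2) a v) ` admissible m1 m2"
  then obtain a1 a2 a3 a4 where "w = monomial_op (rho f1) (rho f2) (a1, a2, a3, a4) v"
    "(a1, a2, a3, a4) \<in> admissible m1 m2" by force
  then show "w \<in> monomial_vectors rho m1 m2 v"
    unfolding monomial_vectors_def admissible_real by auto
qed

lemma finite_admissible: "finite (admissible m1 m2)"
proof (rule finite_subset)
  show "admissible m1 m2 \<subseteq> {..m2} \<times> {..m1 + 2 * m2} \<times> {..m1 + 2 * m2} \<times> {..m1}"
    by (auto simp: admissible_def)
qed simp

theorem mainTheorem1:
  fixes scale :: "complex \<Rightarrow> 'v::ab_group_add \<Rightarrow> 'v"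
    and rho :: "complex^4^4 \<Rightarrow> 'v \<Rightarrow> 'v"
    and m1 m2 :: nat
    and v :: 'v
  assumes "sp4_irrep scale rho m1 m2 v"
  shows "(\<exists>\<phi>. bij_betw \<phi> (monomial_vectors rho m1 m2 v) (KN_tableaux (m1 + m2) m2) \<and>
           (\<forall>w\<in>monomial_vectors rho m1 m2 v.
              sp4_representation.weight_vector scale rho (wt (\<phi> w)) w)) \<and>
         sp4_representation.is_basis scale (monomial_vectors rho m1 m2 v)"
proof -
  interpret sp4_irrep scale rho m1 m2 v by (rule assms)
  interpret chevalley: sp4_hw_irrep scale "rho e1" "rho e2" "rho f1" "rho f2" "rho h1" "rho h2" v m1 m2
    "rho root_y" "rho root_z"
    by (rule chevalley_action)
  let ?mono = "\<lambda>a. monomial_op (rho f1) (rho f2) a v" and ?A = "admissible m1 m2"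
  \<comment> \<open>F is a set of vectors, so distinct exponents must be seen to give distinct
    vectors: a coincidence would be a relation with coefficients 1 and -1.\<close>
  have inj: "inj_on ?mono ?A"
  proof (rule inj_onI, rule ccontr)
    fix a b assume ab: "a \<in> ?A" "b \<in> ?A" "?mono a = ?mono b" "a \<noteq> b"
    then have "(\<Sum>x\<in>{a, b}. scale (if x = a then 1 else - 1) (?mono x)) = 0" by simp
    then have "(if a = a then 1 else - 1 :: complex) = 0"
      by (rule chevalley.monomials_independent[rotated 2]) (use ab in auto)
    then show False by simp
  qed
  have basis: "is_basis (?mono ` ?A)"
    unfolding is_basis_def
  proof (intro conjI independent_if_scalars_zero)
    fix c x assume sum: "(\<Sum>x\<in>?mono ` ?A. scale (c x) x) = 0" and "x \<in> ?mono ` ?A"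
    then obtain a where a: "a \<in> ?A" "x = ?mono a" by blast
    have "(\<Sum>a\<in>?A. scale (c (?mono a)) (?mono a)) = 0"
      using sum sum.reindex[OF inj, of "\<lambda>x. scale (c x) x"] by (simp only: o_def)
    then show "c x = 0"
      using chevalley.monomials_independent[OF finite_admissible subset_refl _ a(1), of "\<lambda>a. c (?mono a)"] a(2)
      by blast
  qed (simp_all add: finite_admissible chevalley.span_admissible_monomials del: monomial_op.simps)
  define \<phi> where "\<phi> = tableau_of m1 m2 \<circ> the_inv_into ?A ?mono"
  have "bij_betw \<phi> (?mono ` ?A) (KN_tableaux (m1 + m2) m2)"
    unfolding \<phi>_def using inj by (intro bij_betw_trans[OF _ bij_betw_tableau_of] bij_betw_the_inv_into)
      (simp add: bij_betw_def)
  moreover have "weight_vector (wt (\<phi> w)) w" if w: "w \<in> ?mono ` ?A" for w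
  proof -
    obtain a1 a2 a3 a4 where a: "(a1, a2, a3, a4) \<in> ?A" "w = ?mono (a1, a2, a3, a4)"
      using w by force
    have \<phi>: "\<phi> w = tableau_of m1 m2 (a1, a2, a3, a4)"
      unfolding \<phi>_def o_apply a(2) the_inv_into_f_f[OF inj a(1)] ..
    show ?thesis
      unfolding weight_vector_def \<phi> wt_tableau_of[OF a(1)] unfolding a(2)
      using chevalley.monomial_nonzero[OF a(1)] weight_monomial[OF _ refl] by blast
  qed
  ultimately show ?thesis
    unfolding monomial_vectors_eq using basis by blast
qed

end
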